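(* The tropical combinatorial types of full-dimensional polytropes in $\mathbb{TA}^{n-1}$ are in bijection with the regular central subdivisions of the fundamental polytopes $\Delta_G$, where $G$ ranges over transitive directed graphs on the node set $[n]$.
   Context: Work over the min-plus semiring $\mathbb{T}=\mathbb{R}\cup\{\infty\}$ ($\oplus=\min$, $\odot=+$); $\mathbb{TA}^{d-1}=\mathbb{R}^d/\mathbb{R}\mathbf{1}$ and $\mathbb{TP}^{d-1}=(\mathbb{T}^d\setminus\{(\infty,\dots,\infty)\})/\mathbb{R}\mathbf{1}$. For $V\in\mathbb{T}^{d\times n}$ (columns $v^{(1)},\dots,v^{(n)}\in\mathbb{TP}^{d-1}$) with a finite entry in every row and column, $\operatorname{tconv}(V)=\{V\odot\lambda:\lambda\in\mathbb{R}^n\}\subseteq\mathbb{TA}^{d-1}$ with $(V\odot\lambda)_i=\min_j(v_{ij}+\lambda_j)$. A polytrope is a set $P=\operatorname{tconv}(V)\subseteq\mathbb{TA}^{d-1}$ (for some such finite $V$) that is convex in the classical sense under $\mathbb{TA}^{d-1}\cong\mathbb{R}^{d-1}$. For $v\in\mathbb{TP}^{d-1}$ let $\alpha_v(x)=\max\{x_\ell-v_\ell: v_\ell\neq\infty\}$ and, for $v_i\ne\infty$, $S_i(v)=\{x\in\mathbb{TA}^{d-1}: x_i-v_i=\alpha_v(x)\}$. The affine covector of $p\in\mathbb{TA}^{d-1}$ relative to $V$ is the bipartite graph on $[n]\sqcup[d]$ with an edge $(j,i)$ iff $v^{(j)}_i\neq\infty$ and $p\in S_i(v^{(j)})$. The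 tropical combinatorial type $\mathrm{TC}(V)$ is the poset (under inclusion of edge sets) of all affine covectors of points of $\mathbb{TA}^{d-1}$ relative to $V$. Two configurations $V,W$ of $n$ points in $\mathbb{TP}^{d-1}$ are tropically equivalent if there are permutations $(\tau,\sigma)\in S_n\times S_d$ of the points and coordinates inducing a poset isomorphism $\mathrm{TC}(V)\to\mathrm{TC}(W)$; tropical polyhedra $\operatorname{tconv}(V)$, $\operatorname{tconv}(W)$ are tropically equivalent if $V,W$ are, and a tropical combinatorial type is an equivalence class. For a directed graph $G$ on $[n]$ the fundamental polytope is $\Delta_G=\operatorname{conv}(\{e_i-e_j : j\to i\in G\}\cup\{0\})\subseteq\mathbb{R}^n$, considered as the point configuration $\{0\}\cup\{e_i-e_j\}$. A subdivision of a finite point configuration $A$ is regular if it is induced by some height function $h\in\mathbb{R}^A$ (projection of the lower faces of $\operatorname{conv}\{(a,h(a))\}$). A subdivision of $\Delta_G$ is central if the origin $0$ is a vertex of every maximal cell. A directed graph is transitive if $j\to k$ and $k\to i$ being edges implies $j\to i$ is an edge.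
   Formalization: Regular central subdivisions are counted up to relabelling of the nodes [n], since tropical types forget coordinate labels (for n = 2: 3 types but 4 labelled subdivisions); the type of a polytrope is that of its irredundant generators. *)

theory Defs
  imports "HOL-Analysis.Analysis"
begin

text \<open>
  The index type \<open>'n\<close> plays the role of the node set \<open>[n]\<close>, so \<open>n = CARD('n)\<close> is an arbitrary
  positive integer. The min-plus semiring consists of the elements of \<^typ>\<open>ereal\<close> other
  than \<open>-\<infinity>\<close>. Points of tropical projective space are given by representatives in
  \<^typ>\<open>ereal^'n\<close>; every notion below is invariant under adding a real constant to all coordinates
  of a point. A subset of the tropical affine space \<open>\<real>\<^sup>n/\<real>\<one>\<close> is represented by its preimage
  in \<open>\<real>\<^sup>n\<close>.
\<close>

section \<open>Tropical convexity and polytropes\<close>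

text \<open>A configuration is the list of the columns of a matrix.\<close>

definition trop_config :: "(ereal^'n) list \<Rightarrow> bool" where
  "trop_config V \<longleftrightarrow>
     (\<forall>j<length V. \<forall>i. V ! j $ i \<noteq> -\<infinity>) \<and>
     (\<forall>j<length V. \<exists>i. V ! j $ i \<noteq> \<infinity>) \<and>
     (\<forall>i. \<exists>j<length V. V ! j $ i \<noteq> \<infinity>)"

definition trop_mult :: "(ereal^'n) list \<Rightarrow> (nat \<Rightarrow> real) \<Rightarrow> ereal^'n" where
  "trop_mult V l = (\<chi> i. INF j\<in>{..<length V}. V ! j $ i + ereal (l j))"

text \<open>Since the coefficients \<open>l\<close> are arbitrary reals, \<open>tconv V\<close> is closed under translation by
  \<open>\<real>\<one>\<close>.\<close>

definition tconv :: "(ereal^'n) list \<Rightarrow> (real^'n) set" where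
  "tconv V = {x. \<exists>l. (\<chi> i. ereal (x $ i)) = trop_mult V l}"

definition polytrope :: "(real^'n) set \<Rightarrow> bool" where
  "polytrope P \<longleftrightarrow> convex P \<and> (\<exists>V. trop_config V \<and> P = tconv V)"

text \<open>Dimension \<open>n - 1\<close> in \<open>\<real>\<^sup>n/\<real>\<one>\<close> corresponds to dimension \<open>n\<close> of the preimage.\<close>

definition full_dim_polytropes :: "(real^'n) set set" where
  "full_dim_polytropes = {P. polytrope P \<and> aff_dim P = int CARD('n)}"

section \<open>Covectors and tropical combinatorial types\<close>

definition trop_alpha :: "ereal^'n \<Rightarrow> real^'n \<Rightarrow> real" where
  "trop_alpha v x = Max {x $ l - real_of_ereal (v $ l) | l. v $ l \<noteq> \<infinity>}"

definition sector :: "'n \<Rightarrow> ereal^'n \<Rightarrow> (real^'n) set" where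
  "sector i v = {x. x $ i - real_of_ereal (v $ i) = trop_alpha v x}"

definition covector :: "(ereal^'n) list \<Rightarrow> real^'n \<Rightarrow> (nat \<times> 'n) set" where
  "covector V p = {(j, i). j < length V \<and> V ! j $ i \<noteq> \<infinity> \<and> p \<in> sector i (V ! j)}"

definition TC :: "(ereal^'n) list \<Rightarrow> (nat \<times> 'n) set set" where
  "TC V = range (covector V)"

definition config_equiv :: "(ereal^'n) list \<Rightarrow> (ereal^'n) list \<Rightarrow> bool" where
  "config_equiv V W \<longleftrightarrow> length V = length W \<and>
     (\<exists>\<tau> \<sigma>. \<tau> permutes {..<length V} \<and> \<sigma> permutes UNIV \<and>
        bij_betw (image (map_prod \<tau> \<sigma>)) (TC V) (TC W) \<and>
        (\<forall>E\<in>TC V. \<forall>F\<in>TC V. E \<subseteq> F \<longleftrightarrow> map_prod \<tau> \<sigma> ` E \<subseteq> map_prod \<tau> \<sigma> ` F))"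

text \<open>The combinatorial type of a tropical polyhedron is that of its generators, which are unique
  (up to order and choice of representatives) once no generator can be dropped. Redundant
  generators would change \<open>TC\<close> without changing \<open>tconv\<close>.\<close>

definition irredundant :: "(ereal^'n) list \<Rightarrow> bool" where
  "irredundant V \<longleftrightarrow> (\<forall>j<length V. tconv (take j V @ drop (Suc j) V) \<noteq> tconv V)"

definition polytrope_equiv :: "((real^'n) set \<times> (real^'n) set) set" where
  "polytrope_equiv = {(P, Q). P \<in> full_dim_polytropes \<and> Q \<in> full_dim_polytropes \<and>
     (\<exists>V W. trop_config V \<and> irredundant V \<and> P = tconv V \<and>
            trop_config W \<and> irredundant W \<and> Q = tconv W \<and> config_equiv V W)}"

definition polytrope_types :: "(real^'n) set set set" where
  "polytrope_types = full_dim_polytropes // polytrope_equiv"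

section \<open>Regular subdivisions of fundamental polytopes\<close>

text \<open>A pair \<open>(j, i) \<in> G\<close> is an edge from \<open>j\<close> to \<open>i\<close>. Loops are allowed (a transitive graph
  containing a directed cycle has them); they contribute the point \<open>0\<close>, which is present anyway.\<close>

definition fundamental_config :: "('n \<times> 'n) set \<Rightarrow> (real^'n) set" where
  "fundamental_config G = insert 0 {axis i 1 - axis j 1 | i j. (j, i) \<in> G}"

definition lifted_polytope :: "'a::euclidean_space set \<Rightarrow> ('a \<Rightarrow> real) \<Rightarrow> ('a \<times> real) set" where
  "lifted_polytope A h = convex hull ((\<lambda>a. (a, h a)) ` A)"

definition lower_face :: "('a::euclidean_space \<times> real) set \<Rightarrow> ('a \<times> real) set \<Rightarrow> bool" where
  "lower_face F L \<longleftrightarrow> F \<noteq> {} \<and>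
     (\<exists>u c b. c < 0 \<and> L \<subseteq> {p. (u, c) \<bullet> p \<le> b} \<and> F = L \<inter> {p. (u, c) \<bullet> p = b})"

text \<open>A subdivision is the collection of all of its nonempty cells. Only the values of \<open>h\<close> on \<open>A\<close>
  matter.\<close>

definition induced_subdivision :: "'a::euclidean_space set \<Rightarrow> ('a \<Rightarrow> real) \<Rightarrow> 'a set set" where
  "induced_subdivision A h = {fst ` F | F. lower_face F (lifted_polytope A h)}"

definition regular_subdivision :: "'a::euclidean_space set \<Rightarrow> 'a set set \<Rightarrow> bool" where
  "regular_subdivision A S \<longleftrightarrow> (\<exists>h. S = induced_subdivision A h)"

definition central :: "'a::euclidean_space set set \<Rightarrow> bool" where
  "central S \<longleftrightarrow> (\<forall>C\<in>S. (\<forall>D\<in>S. C \<subseteq> D \<longrightarrow> D = C) \<longrightarrow> 0 extreme_point_of C)"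

text \<open>The graph is recovered from a central subdivision up to loops, because every point
  \<open>e\<^sub>i - e\<^sub>j\<close> with \<open>i \<noteq> j\<close> is a vertex of the fundamental polytope. Hence no information is lost
  by taking the union over all transitive graphs.\<close>

definition regular_central_subdivisions :: "(real^'n) set set set" where
  "regular_central_subdivisions =
     (\<Union>G\<in>{G. trans G}. {S. regular_subdivision (fundamental_config G) S \<and> central S})"

definition relabel :: "('n \<Rightarrow> 'n) \<Rightarrow> real^'n \<Rightarrow> real^'n" where
  "relabel \<sigma> x = (\<chi> i. x $ inv \<sigma> i)"

text \<open>Tropical equivalence forgets the labels of the coordinates, so subdivisions are likewise
  considered up to renaming the nodes, that is up to the action \<open>e\<^sub>i \<mapsto> e\<^bsub>\<sigma>(i)\<^esub>\<close> of the
  symmetric group. Without this identification the two sides differ already for \<open>n = 2\<close>: there are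
  three tropical types (line, half-line, segment) but four labelled subdivisions, one for each
  of the four loop-free edge sets on two nodes.\<close>

definition subdivision_equiv :: "((real^'n) set set \<times> (real^'n) set set) set" where
  "subdivision_equiv =
     {(S, T). S \<in> regular_central_subdivisions \<and> T \<in> regular_central_subdivisions \<and>
        (\<exists>\<sigma>. \<sigma> permutes UNIV \<and> T = image (relabel \<sigma>) ` S)}"

definition subdivision_types :: "(real^'n) set set set set" where
  "subdivision_types = regular_central_subdivisions // subdivision_equiv"

end

theory Submission
  imports Defs
begin

text \<open>Both sides are parametrised by strict Kleene stars: matrices \<open>c\<close> over the min-plus semiring
  with zero diagonal, \<open>c\<^sub>i\<^sub>j \<le> c\<^sub>i\<^sub>k + c\<^sub>k\<^sub>j\<close>, and \<open>c\<^sub>i\<^sub>j + c\<^sub>j\<^sub>i > 0\<close> for \<open>i \<noteq> j\<close>. The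
  full-dimensional polytropes are the alcoves \<open>{x. x\<^sub>i - x\<^sub>j \<le> c\<^sub>i\<^sub>j}\<close>, with the columns of \<open>c\<close> as their
  only irredundant generators; the regular central subdivisions are those induced by the heights
  \<open>h(e\<^sub>i - e\<^sub>j) = c\<^sub>i\<^sub>j\<close>. Let \<open>K c\<close> (the constant \<open>alcove_types\<close>) be the set of the graphs \<open>{(j, i). x\<^sub>i - x\<^sub>j = c\<^sub>i\<^sub>j}\<close> for \<open>x\<close> in the
  alcove. All covectors are faces of graphs in \<open>K c\<close>, and the members of \<open>K c\<close> are the covectors without
  isolated coordinates; likewise all cells are faces of cells corresponding to \<open>K c\<close>, and the latter
  are the cells containing \<open>0\<close>. So both equivalences say that \<open>K c\<close> and \<open>K c'\<close> agree up to a
  relabelling of the nodes. A pair \<open>(\<tau>, \<sigma>)\<close> of permutations must have \<open>\<tau> = \<sigma>\<close>, because the least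
  member of \<open>K c\<close> is the diagonal.\<close>

section \<open>Kleene stars and their alcoves\<close>

text \<open>Feasible pairs \<open>(x, l)\<close> treat both sides at once: with \<open>l\<close> the
  vector of residua of \<open>x\<close> against the columns, the tight entries form the covector of
  \<open>x\<close>; with \<open>l = x + b\<close> they form the contact set of an affine function
  below the lifted roots; \<open>l = x\<close> is the common case, the alcove. Pulling a feasible
  pair to a point \<open>w\<close> of the alcove leaves a functional \<open>(x - w, l - w)\<close>
  on the graph of \<open>w\<close>. It mentions the graph but not \<open>c\<close>, so
  \<open>K c\<close> alone determines covectors and cells, and relabellings carry over. The
  recurring obstacle is infinite entries: a generator or column may fail to be a point of the affine
  space. Its truncations \<open>min (v, p + T)\<close>, with \<open>p\<close> in the set, replace
  it, and the limit of large \<open>T\<close> returns the inequalities between its entries.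
  Strictness means full dimension on one side; on the other it says that no cell through the origin
  contains two antipodal roots, as centrality demands.\<close>

definition kleene_star :: "('n::finite \<Rightarrow> 'n \<Rightarrow> ereal) \<Rightarrow> bool" where
  "kleene_star c \<longleftrightarrow> (\<forall>i. c i i = 0) \<and> (\<forall>i j. c i j \<noteq> -\<infinity>) \<and> (\<forall>i j k. c i j \<le> c i k + c k j)"

definition strict_star :: "('n::finite \<Rightarrow> 'n \<Rightarrow> ereal) \<Rightarrow> bool" where
  "strict_star c \<longleftrightarrow> kleene_star c \<and> (\<forall>i j. i \<noteq> j \<longrightarrow> 0 < c i j + c j i)"

definition feasible :: "('n::finite \<Rightarrow> 'n \<Rightarrow> ereal) \<Rightarrow> real^'n \<Rightarrow> real^'n \<Rightarrow> bool" where
  "feasible c x l \<longleftrightarrow> (\<forall>i j. ereal (x $ i - l $ j) \<le> c i j)"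

definition tight :: "('n::finite \<Rightarrow> 'n \<Rightarrow> ereal) \<Rightarrow> real^'n \<Rightarrow> real^'n \<Rightarrow> ('n \<times> 'n) set" where
  "tight c x l = {(j, i). c i j = ereal (x $ i - l $ j)}"

definition alcove :: "('n::finite \<Rightarrow> 'n \<Rightarrow> ereal) \<Rightarrow> (real^'n) set" where
  "alcove c = {x. feasible c x x}"

definition alcove_types :: "('n::finite \<Rightarrow> 'n \<Rightarrow> ereal) \<Rightarrow> ('n \<times> 'n) set set" where
  "alcove_types c = (\<lambda>x. tight c x x) ` alcove c"

text \<open>Reading an edge \<open>(j, i)\<close> as the vector \<open>(e_i, - e_j)\<close>, the
  functional \<open>(y, m)\<close> is nonpositive on \<open>E\<close> and vanishes exactly on
  \<open>F\<close>: \<open>F\<close> is a face of the cone spanned by \<open>E\<close>.\<close>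

definition face_by :: "real^'n \<Rightarrow> real^'n \<Rightarrow> ('n \<times> 'n) set \<Rightarrow> ('n \<times> 'n) set \<Rightarrow> bool" where
  "face_by y m E F \<longleftrightarrow> (\<forall>(j, i)\<in>E. y $ i \<le> m $ j) \<and> F = {(j, i) \<in> E. y $ i = m $ j}"

lemma strict_star_kleene: "strict_star c \<Longrightarrow> kleene_star c"
  by (simp add: strict_star_def)

lemma kleene_star_refl: "kleene_star c \<Longrightarrow> c i i = 0"
  by (simp add: kleene_star_def)

lemma kleene_star_not_minf: "kleene_star c \<Longrightarrow> c i j \<noteq> -\<infinity>"
  by (simp add: kleene_star_def)

lemma kleene_star_triangle:
  assumes "kleene_star c" "c i k \<le> ereal a" "c k j \<le> ereal b"
  shows "c i j \<le> ereal (a + b)"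
proof -
  have "c i j \<le> c i k + c k j" using assms(1) by (simp add: kleene_star_def)
  also have "\<dots> \<le> ereal a + ereal b" by (rule add_mono[OF assms(2,3)])
  finally show ?thesis by simp
qed

lemma alcoveD: "x \<in> alcove c \<Longrightarrow> ereal (x $ i - x $ j) \<le> c i j"
  by (simp add: alcove_def feasible_def)

lemma alcoveI: "(\<And>i j. ereal (x $ i - x $ j) \<le> c i j) \<Longrightarrow> x \<in> alcove c"
  by (simp add: alcove_def feasible_def)

lemma Id_subset_tight: "kleene_star c \<Longrightarrow> Id \<subseteq> tight c x x"
  by (auto simp: tight_def kleene_star_refl zero_ereal_def)

text \<open>The witness \<open>w\<^sub>j = max\<^sub>i (x\<^sub>i - c\<^sub>i\<^sub>j)\<close> is the smallest \<open>l\<close> for which \<open>(x, l)\<close> is feasible.\<close>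

lemma feasible_face:
  fixes x l :: "real^'n"
  assumes c: "kleene_star c" and f: "feasible c x l"
  obtains w where "w \<in> alcove c" "face_by (x - w) (l - w) (tight c w w) (tight c x l)"
proof -
  define A where "A j = {x $ i - r | i r. c i j = ereal r}" for j
  have A_image: "A j = (\<lambda>i. x $ i - real_of_ereal (c i j)) ` {i. c i j \<noteq> \<infinity>}" for j
  proof (intro equalityI subsetI)
    fix a assume "a \<in> (\<lambda>i. x $ i - real_of_ereal (c i j)) ` {i. c i j \<noteq> \<infinity>}"
    then obtain i where i: "a = x $ i - real_of_ereal (c i j)" "c i j \<noteq> \<infinity>" by auto
    moreover have "c i j \<noteq> -\<infinity>" using c by (simp add: kleene_star_def)
    ultimately obtain r where "c i j = ereal r" by (cases "c i j") auto
    with i show "a \<in> A j" unfolding A_def by auto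
  next
    fix a assume "a \<in> A j"
    then obtain i r where "a = x $ i - r" "c i j = ereal r" by (auto simp: A_def)
    then show "a \<in> (\<lambda>i. x $ i - real_of_ereal (c i j)) ` {i. c i j \<noteq> \<infinity>}"
      by (intro image_eqI[of _ _ i]) auto
  qed
  then have fin: "finite (A j)" for j by simp
  have self: "x $ j \<in> A j" for j
    unfolding A_def using kleene_star_refl[OF c, of j] by (force simp: zero_ereal_def)
  define w :: "real^'n" where "w = (\<chi> j. Max (A j))"
  have w_ge: "x $ i - r \<le> w $ j" if "c i j = ereal r" for i j r
    unfolding w_def using that fin by (auto simp: A_def intro!: Max_ge)
  have w_in: "w $ j \<in> A j" for j
    unfolding w_def using Max_in[OF fin] self by fastforce
  have w_feas: "ereal (x $ i - w $ j) \<le> c i j" for i j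
    using w_ge[of i j] kleene_star_not_minf[OF c, of i j] by (cases "c i j") (auto simp: algebra_simps)
  have w_le: "w $ j \<le> l $ j" for j
  proof -
    obtain i r where "w $ j = x $ i - r" "c i j = ereal r" using w_in[of j] by (auto simp: A_def)
    with f show ?thesis unfolding feasible_def
      by (metis add.commute diff_le_eq ereal_less_eq(3))
  qed
  have w_alcove: "w \<in> alcove c"
  proof (rule alcoveI)
    fix i j
    show "ereal (w $ i - w $ j) \<le> c i j"
    proof (cases "c i j")
      case (real r)
      obtain k s where k: "w $ i = x $ k - s" "c k i = ereal s" using w_in[of i] by (auto simp: A_def)
      have "c k j \<le> ereal (s + r)" by (rule kleene_star_triangle[OF c, of k i s j r]) (use k real in auto)
      with w_feas[of k j] have "ereal (x $ k - w $ j) \<le> ereal (s + r)" by (rule order_trans)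
      then show ?thesis using k real by simp
    qed (use kleene_star_not_minf[OF c, of i j] in auto)
  qed
  \<comment> \<open>Tightness at \<open>(j, i)\<close> means that \<open>i\<close> attains the
    maximum, so \<open>w $ j = l $ j\<close>; since \<open>x \<le> w\<close>, the bound
    \<open>w $ i - w $ j \<le> c i j\<close> becomes an equality.\<close>
  have tight_w: "c i j = ereal (w $ i - w $ j)" if t: "c i j = ereal (x $ i - l $ j)" for i j
  proof -
    have "w $ j = l $ j" using w_ge[OF t] w_le[of j] by simp
    moreover have "x $ i \<le> w $ i" using w_ge[of i i 0] kleene_star_refl[OF c] by (simp add: zero_ereal_def)
    moreover have "w $ i - w $ j \<le> x $ i - l $ j" using alcoveD[OF w_alcove, of i j] t by simp
    ultimately show ?thesis using t by simp
  qed
  have "face_by (x - w) (l - w) (tight c w w) (tight c x l)"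
    unfolding face_by_def
  proof (intro conjI)
    show "\<forall>(j, i)\<in>tight c w w. (x - w) $ i \<le> (l - w) $ j"
    proof (clarify, simp add: tight_def)
      fix i j assume "c i j = ereal (w $ i - w $ j)"
      moreover have "ereal (x $ i - l $ j) \<le> c i j" using f by (simp add: feasible_def)
      ultimately show "x $ i - w $ i \<le> l $ j - w $ j" by simp
    qed
    show "tight c x l = {(j, i). (j, i) \<in> tight c w w \<and> (x - w) $ i = (l - w) $ j}"
      using tight_w by (auto simp: tight_def algebra_simps)
  qed
  with w_alcove show ?thesis by (rule that)
qed

text \<open>A short move from \<open>(w, w)\<close> in direction \<open>(y, m)\<close>: the finitely
  many slack inequalities stay slack by continuity, and a tight one stays tight exactly where
  \<open>y\<close> and \<open>m\<close> agree, that is on \<open>F\<close>.\<close>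

lemma face_feasible:
  fixes w y m :: "real^'n"
  assumes w: "w \<in> alcove c" and f: "face_by y m (tight c w w) F"
  obtains e where "e > 0" "feasible c (w + e *\<^sub>R y) (w + e *\<^sub>R m)"
    "tight c (w + e *\<^sub>R y) (w + e *\<^sub>R m) = F"
proof -
  have "\<forall>\<^sub>F e in at_right (0::real). ereal ((w + e *\<^sub>R y) $ i - (w + e *\<^sub>R m) $ j) < c i j"
    if "(j, i) \<notin> tight c w w" for i j
  proof -
    have "ereal (w $ i - w $ j) < c i j"
      using alcoveD[OF w, of i j] that by (auto simp: tight_def less_le)
    moreover have "((\<lambda>e. ereal ((w + e *\<^sub>R y) $ i - (w + e *\<^sub>R m) $ j)) \<longlongrightarrow>
      ereal ((w + 0 *\<^sub>R y) $ i - (w + 0 *\<^sub>R m) $ j)) (at_right 0)"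
      by (intro tendsto_intros)
    ultimately show ?thesis by (intro order_tendstoD) auto
  qed
  then have "\<forall>\<^sub>F e in at_right (0::real). \<forall>i j. (j, i) \<notin> tight c w w \<longrightarrow>
      ereal ((w + e *\<^sub>R y) $ i - (w + e *\<^sub>R m) $ j) < c i j"
    by (simp add: eventually_all_finite)
  then have "\<forall>\<^sub>F e in at_right (0::real). e > 0 \<and> (\<forall>i j. (j, i) \<notin> tight c w w \<longrightarrow>
      ereal ((w + e *\<^sub>R y) $ i - (w + e *\<^sub>R m) $ j) < c i j)"
    by (intro eventually_conj eventually_at_right_less)
  then obtain e :: real where e: "e > 0" "\<And>i j. (j, i) \<notin> tight c w w \<Longrightarrow>
      ereal ((w + e *\<^sub>R y) $ i - (w + e *\<^sub>R m) $ j) < c i j"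
    using eventually_happens[of _ "at_right (0::real)"] trivial_limit_at_right_real by blast
  have le: "y $ i \<le> m $ j" if "(j, i) \<in> tight c w w" for i j
    using f that by (auto simp: face_by_def)
  have on: "ereal ((w + e *\<^sub>R y) $ i - (w + e *\<^sub>R m) $ j) \<le> c i j"
           "c i j = ereal ((w + e *\<^sub>R y) $ i - (w + e *\<^sub>R m) $ j) \<longleftrightarrow> y $ i = m $ j"
    if t: "(j, i) \<in> tight c w w" for i j
  proof -
    have "c i j = ereal (w $ i - w $ j)" using t by (simp add: tight_def)
    moreover have "e * y $ i \<le> e * m $ j" using le[OF t] e(1) by simp
    ultimately show "ereal ((w + e *\<^sub>R y) $ i - (w + e *\<^sub>R m) $ j) \<le> c i j"
      "c i j = ereal ((w + e *\<^sub>R y) $ i - (w + e *\<^sub>R m) $ j) \<longleftrightarrow> y $ i = m $ j"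
      using e(1) by auto
  qed
  show ?thesis
  proof (rule that[OF e(1)])
    show "feasible c (w + e *\<^sub>R y) (w + e *\<^sub>R m)"
      unfolding feasible_def using on(1) e(2) less_imp_le by blast
    have "F = {(j, i). (j, i) \<in> tight c w w \<and> y $ i = m $ j}" using f by (simp add: face_by_def)
    also have "\<dots> = tight c (w + e *\<^sub>R y) (w + e *\<^sub>R m)"
    proof -
      have "c i j = ereal ((w + e *\<^sub>R y) $ i - (w + e *\<^sub>R m) $ j) \<longleftrightarrow>
        (j, i) \<in> tight c w w \<and> y $ i = m $ j" for i j
        using on(2)[of j i] e(2)[of j i] by (metis less_irrefl)
      then show ?thesis unfolding tight_def[of c "w + e *\<^sub>R y" "w + e *\<^sub>R m"] by simp
    qed
    finally show "tight c (w + e *\<^sub>R y) (w + e *\<^sub>R m) = F" by simp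
  qed
qed

section \<open>Points of the alcove and of its interior\<close>

lemma alcove_nonempty:
  assumes c: "kleene_star c"
  obtains p where "p \<in> alcove c"
proof -
  \<comment> \<open>Any \<open>x\<close>, here the origin, becomes feasible for large
    \<open>l\<close>. Infinite entries enter the maximum with the default value \<open>0\<close>,
    which can only enlarge \<open>l\<close>.\<close>
  define l where "l = (\<chi> j. Max (range (\<lambda>i. - real_of_ereal (c i j))))"
  have "feasible c 0 l"
    unfolding feasible_def
  proof (intro allI)
    fix i j
    have "- real_of_ereal (c i j) \<le> l $ j" unfolding l_def by (auto intro!: Max_ge)
    then show "ereal (0 $ i - l $ j) \<le> c i j"
      using kleene_star_not_minf[OF c, of i j] by (cases "c i j") auto
  qed
  with c show ?thesis by (rule feasible_face) (use that in blast)
qed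

text \<open>Real vectors approximating a vector \<open>v\<close> with possibly infinite entries, as \<open>T\<close> grows.\<close>

definition truncate :: "ereal^'n \<Rightarrow> real^'n \<Rightarrow> real \<Rightarrow> real^'n" where
  "truncate v p T = (\<chi> i. real_of_ereal (min (v $ i) (ereal (p $ i + T))))"

definition column :: "('n::finite \<Rightarrow> 'n \<Rightarrow> ereal) \<Rightarrow> 'n \<Rightarrow> ereal^'n" where
  "column c j = (\<chi> i. c i j)"

lemma column_nth [simp]: "column c j $ i = c i j"
  by (simp add: column_def)

lemma truncate_nth:
  "v $ i \<noteq> -\<infinity> \<Longrightarrow> ereal (truncate v p T $ i) = min (v $ i) (ereal (p $ i + T))"
  unfolding truncate_def by (cases "v $ i") (auto simp: min_def)

text \<open>The conditions \<open>x $ i \<le> r + x $ k\<close> are stable under coordinatewise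
  minima: the column satisfies them by the triangle inequality, \<open>p + T\<close> because
  \<open>p\<close> does.\<close>

lemma truncated_column_in_alcove:
  assumes c: "kleene_star c" and p: "p \<in> alcove c"
  shows "truncate (column c j) p T \<in> alcove c"
proof -
  define x where "x = truncate (column c j) p T"
  have eq: "ereal (x $ i) = min (c i j) (ereal (p $ i + T))" for i
    unfolding x_def using truncate_nth[of "column c j" i p T] kleene_star_not_minf[OF c, of i j] by simp
  have "x \<in> alcove c"
  proof (rule alcoveI)
    fix i k
    show "ereal (x $ i - x $ k) \<le> c i k"
    proof (cases "c i k")
      case (real r)
      have "ereal (x $ i) \<le> ereal (r + x $ k)"
      proof (cases "c k j \<le> ereal (p $ k + T)")
        case True
        then have "c k j = ereal (x $ k)" using eq[of k] by (simp add: min_def)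
        then have "c i j \<le> ereal (r + x $ k)" using kleene_star_triangle[OF c, of i k r j] real by simp
        then show ?thesis unfolding eq[of i] by (simp add: min_le_iff_disj)
      next
        case False
        then have k: "x $ k = p $ k + T" using eq[of k] by (simp add: min_def)
        have "p $ i - p $ k \<le> r" using alcoveD[OF p, of i k] real by simp
        then have "ereal (p $ i + T) \<le> ereal (r + x $ k)" using k by simp
        then show ?thesis unfolding eq[of i] by (simp add: min_le_iff_disj)
      qed
      then show ?thesis using real by simp
    qed (use kleene_star_not_minf[OF c, of i k] in auto)
  qed
  then show ?thesis by (simp add: x_def)
qed

text \<open>Truncating column \<open>i\<close> makes the inequalities
  \<open>x $ i - x $ j < c i j\<close> of the one row \<open>i\<close> strict, because
  \<open>c j i > - c i j\<close>. The average over all \<open>i\<close> is strict in every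
  row.\<close>

lemma strict_star_interior:
  fixes c :: "'n::finite \<Rightarrow> 'n \<Rightarrow> ereal"
  assumes c: "strict_star c"
  obtains w where "w \<in> alcove c" "\<And>i j. i \<noteq> j \<Longrightarrow> ereal (w $ i - w $ j) < c i j"
proof -
  have k: "kleene_star c" using c by (rule strict_star_kleene)
  obtain p where p: "p \<in> alcove c" using k by (rule alcove_nonempty)
  have "\<exists>x\<in>alcove c. \<forall>j. i \<noteq> j \<longrightarrow> ereal (x $ i - x $ j) < c i j" for i
  proof -
    define f where "f j = \<bar>real_of_ereal (c i j)\<bar>" for j
    have f: "0 \<le> f j" for j by (cases "c i j") (auto simp: f_def)
    \<comment> \<open>Large enough that the truncation keeps the entry \<open>0\<close> at
      \<open>i\<close> and that \<open>p $ j + T\<close> exceeds \<open>- c i j\<close> for all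
      \<open>j\<close>; \<open>f\<close> is \<open>0\<close> at infinite entries.\<close>
    define T where "T = \<bar>p $ i\<bar> + (\<Sum>j\<in>UNIV. \<bar>p $ j\<bar> + f j + 1)"
    define x where "x = truncate (column c i) p T"
    have x: "x \<in> alcove c" "\<And>j. ereal (x $ j) = min (c j i) (ereal (p $ j + T))"
      unfolding x_def using truncated_column_in_alcove[OF k p] truncate_nth[of "column c i"]
        kleene_star_not_minf[OF k] by auto
    have T: "\<bar>p $ j\<bar> + f j + 1 \<le> T" for j
    proof -
      have "\<bar>p $ j\<bar> + f j + 1 \<le> (\<Sum>j\<in>UNIV. \<bar>p $ j\<bar> + f j + 1)"
        using f by (intro member_le_sum) (auto intro!: add_nonneg_nonneg)
      then show ?thesis by (simp add: T_def)
    qed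
    have "x $ i = 0" using x(2)[of i] T[of i] kleene_star_refl[OF k, of i]
      by (auto simp: min_def zero_ereal_def f_def split: if_splits)
    moreover have "- c i j < x $ j" if "i \<noteq> j" for j
    proof -
      have "- c i j < c j i" using c that unfolding strict_star_def
        using kleene_star_not_minf[OF k, of i j] kleene_star_not_minf[OF k, of j i]
        by (cases "c i j"; cases "c j i") (fastforce simp: algebra_simps)+
      moreover have "- c i j < ereal (p $ j + T)"
        using T[of j] kleene_star_not_minf[OF k, of i j] by (cases "c i j") (auto simp: f_def)
      ultimately show ?thesis unfolding x(2) by simp
    qed
    ultimately have "\<forall>j. i \<noteq> j \<longrightarrow> ereal (x $ i - x $ j) < c i j"
      by (metis diff_0 ereal_uminus_less_reorder uminus_ereal.simps(1))
    then show ?thesis using x(1) by blast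
  qed
  then obtain q where q: "\<And>i. q i \<in> alcove c" "\<And>i j. i \<noteq> j \<Longrightarrow> ereal (q i $ i - q i $ j) < c i j"
    by metis
  define N where "N = real CARD('n)"
  define w where "w = (\<Sum>k\<in>UNIV. q k) /\<^sub>R N"
  have N: "N > 0" by (simp add: N_def)
  have lt: "ereal (w $ i - w $ j) < c i j" if "i \<noteq> j" for i j
  proof (cases "c i j")
    case (real r)
    have "(\<Sum>k\<in>UNIV. q k $ i - q k $ j) < (\<Sum>k\<in>(UNIV::'n set). r)"
    proof (rule sum_strict_mono_ex1)
      show "\<forall>k\<in>UNIV. q k $ i - q k $ j \<le> r"
        using alcoveD[OF q(1), of _ i j] real by simp
      show "\<exists>k\<in>UNIV. q k $ i - q k $ j < r" using q(2)[OF that] real by auto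
    qed simp
    moreover have "N * w $ k = (\<Sum>l\<in>UNIV. q l $ k)" for k
      using N by (simp add: w_def)
    ultimately have "N * (w $ i - w $ j) < N * r"
      by (simp add: N_def sum_subtractf right_diff_distrib)
    then show ?thesis using N real by simp
  qed (use kleene_star_not_minf[OF k, of i j] in auto)
  moreover have "w \<in> alcove c"
  proof (rule alcoveI)
    fix i j show "ereal (w $ i - w $ j) \<le> c i j"
      using lt[of i j] kleene_star_refl[OF k] by (cases "i = j") (auto simp: zero_ereal_def)
  qed
  ultimately show ?thesis using that by blast
qed

section \<open>Tropical convex hulls\<close>

text \<open>For \<open>v\<close> without entries \<open>-\<infinity>\<close> this says that
  \<open>v $ i\<close> is finite and \<open>x\<close> lies in sector \<open>i\<close> of
  \<open>v\<close>, but without maxima or default values: \<open>x\<close>, translated to meet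
  \<open>v\<close> at \<open>i\<close>, lies below \<open>v\<close>.\<close>

definition hits :: "ereal^'n \<Rightarrow> 'n \<Rightarrow> real^'n \<Rightarrow> bool" where
  "hits v i x \<longleftrightarrow> (\<exists>r. v $ i = ereal r \<and> (\<forall>l. ereal (x $ l - x $ i + r) \<le> v $ l))"

lemma hits_shift:
  assumes "\<And>i. v $ i = w $ i + ereal t" and "hits w i x"
  shows "hits v i x"
proof -
  obtain r where r: "w $ i = ereal r" "\<And>l. ereal (x $ l - x $ i + r) \<le> w $ l"
    using assms(2) by (auto simp: hits_def)
  have "ereal (x $ l - x $ i + (r + t)) \<le> v $ l" for l
    using add_mono[OF r(2)[of l] order_refl[of "ereal t"]] assms(1) by (simp add: algebra_simps)
  then show ?thesis using assms(1)[of i] r(1) unfolding hits_def by auto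
qed

lemma hits_shift_iff:
  assumes "\<And>i. v $ i = w $ i + ereal t"
  shows "hits v i x \<longleftrightarrow> hits w i x"
proof -
  have "w $ i = v $ i + ereal (- t)" for i
    unfolding assms by (cases "w $ i") auto
  then show ?thesis using hits_shift[of v w] hits_shift[of w v] assms by metis
qed

lemma sector_iff_hits:
  assumes "\<And>l. v $ l \<noteq> -\<infinity>" "v $ i \<noteq> \<infinity>"
  shows "p \<in> sector i v \<longleftrightarrow> hits v i p"
proof -
  define S where "S = {p $ l - real_of_ereal (v $ l) | l. v $ l \<noteq> \<infinity>}"
  have fin: "finite S"
    by (rule finite_subset[of _ "range (\<lambda>l. p $ l - real_of_ereal (v $ l))"]) (auto simp: S_def)
  have mem: "p $ i - real_of_ereal (v $ i) \<in> S" using assms by (auto simp: S_def)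
  obtain r where r: "v $ i = ereal r" using assms by (cases "v $ i") (metis | simp)+
  have "p \<in> sector i v \<longleftrightarrow> p $ i - r = Max S"
    by (simp add: sector_def trop_alpha_def S_def r)
  also have "\<dots> \<longleftrightarrow> (\<forall>s\<in>S. s \<le> p $ i - r)"
    using Max_eq_iff[OF fin, of "p $ i - r"] mem r by force
  also have "\<dots> \<longleftrightarrow> (\<forall>l. ereal (p $ l - p $ i + r) \<le> v $ l)"
  proof -
    have "ereal (p $ l - p $ i + r) \<le> v $ l \<longleftrightarrow>
      (v $ l \<noteq> \<infinity> \<longrightarrow> p $ l - real_of_ereal (v $ l) \<le> p $ i - r)" for l
      using assms(1)[of l] by (cases "v $ l") auto
    then show ?thesis by (auto simp: S_def)
  qed
  finally show ?thesis using r by (auto simp: hits_def)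
qed

lemma covector_eq:
  assumes "trop_config V"
  shows "covector V p = {(k, i). k < length V \<and> hits (V ! k) i p}"
proof -
  have "V ! k $ i \<noteq> \<infinity> \<and> p \<in> sector i (V ! k) \<longleftrightarrow> hits (V ! k) i p" if "k < length V" for k i
  proof (cases "V ! k $ i = \<infinity>")
    case False
    with that show ?thesis using assms sector_iff_hits[of "V ! k" i p] by (simp add: trop_config_def)
  qed (simp add: hits_def)
  then show ?thesis unfolding covector_def by auto
qed

lemma hits_exists:
  assumes "\<And>l. v $ l \<noteq> -\<infinity>" "v $ k \<noteq> \<infinity>"
  shows "\<exists>i. hits v i p"
proof -
  define S where "S = {p $ l - real_of_ereal (v $ l) | l. v $ l \<noteq> \<infinity>}"
  have fin: "finite S"
    by (rule finite_subset[of _ "range (\<lambda>l. p $ l - real_of_ereal (v $ l))"]) (auto simp: S_def)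
  moreover have "S \<noteq> {}" using assms(2) by (auto simp: S_def)
  ultimately have "Max S \<in> S" by (rule Max_in)
  then obtain i where "Max S = p $ i - real_of_ereal (v $ i)" "v $ i \<noteq> \<infinity>" by (auto simp: S_def)
  then have "p \<in> sector i v" by (simp add: sector_def trop_alpha_def S_def)
  with \<open>v $ i \<noteq> \<infinity>\<close> show ?thesis using sector_iff_hits[OF assms(1)] by blast
qed

text \<open>If \<open>v\<close> hits \<open>x\<close> anywhere, then \<open>t\<close> is the residuum \<open>trop_alpha v x\<close>; otherwise all entries of \<open>v\<close>
  are infinite, so that \<open>trop_alpha v x\<close> is junk and any \<open>t\<close> will do.\<close>

lemma hits_residuum:
  assumes v: "\<And>l. v $ l \<noteq> -\<infinity>"
  shows "\<exists>t. (\<forall>l. ereal (x $ l) \<le> v $ l + ereal t) \<and> (\<forall>i. hits v i x \<longrightarrow> v $ i + ereal t = ereal (x $ i))"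
proof (cases "\<exists>i. hits v i x")
  case True
  then obtain i r where r: "v $ i = ereal r" "\<And>l. ereal (x $ l - x $ i + r) \<le> v $ l"
    by (auto simp: hits_def)
  have "ereal (x $ l) \<le> v $ l + ereal (x $ i - r)" for l
    using r(2)[of l] by (cases "v $ l") auto
  moreover have "v $ k + ereal (x $ i - r) = ereal (x $ k)" if "hits v k x" for k
  proof -
    obtain s where s: "v $ k = ereal s" "\<And>l. ereal (x $ l - x $ k + s) \<le> v $ l"
      using \<open>hits v k x\<close> by (auto simp: hits_def)
    show ?thesis using r(2)[of k] s(2)[of i] by (simp add: r s)
  qed
  ultimately show ?thesis by blast
next
  case False
  define t where "t = (\<Sum>l\<in>UNIV. \<bar>x $ l - real_of_ereal (v $ l)\<bar>)"
  have "ereal (x $ l) \<le> v $ l + ereal t" for l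
  proof -
    have "\<bar>x $ l - real_of_ereal (v $ l)\<bar> \<le> t"
      unfolding t_def by (rule member_le_sum) auto
    then show ?thesis using v[of l] by (cases "v $ l") auto
  qed
  with False show ?thesis by blast
qed

text \<open>Residuation: for a generator with a finite entry the residuum is the least coefficient
  that keeps it above \<open>x\<close>, so if any coefficients produce \<open>x\<close>, the residua
  do. With them \<open>x $ i\<close> is attained by exactly the generators that hit \<open>x\<close>
  at \<open>i\<close>.\<close>

lemma mem_tconv_iff:
  assumes V: "\<And>v i. v \<in> set V \<Longrightarrow> v $ i \<noteq> -\<infinity>"
  shows "x \<in> tconv V \<longleftrightarrow> (\<forall>i. \<exists>v\<in>set V. hits v i x)"
proof
  assume "x \<in> tconv V"
  then obtain t where t: "(\<chi> i. ereal (x $ i)) = trop_mult V t" by (auto simp: tconv_def)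
  have x: "ereal (x $ i) = (INF k\<in>{..<length V}. V ! k $ i + ereal (t k))" for i
    using t by (simp add: vec_eq_iff trop_mult_def)
  have le: "ereal (x $ i) \<le> V ! k $ i + ereal (t k)" if "k < length V" for i k
    unfolding x using that by (intro INF_lower) auto
  show "\<forall>i. \<exists>v\<in>set V. hits v i x"
  proof
    fix i
    let ?S = "(\<lambda>k. V ! k $ i + ereal (t k)) ` {..<length V}"
    \<comment> \<open>An infimum over no generators would be \<open>\<infinity>\<close> and not the
      real \<open>x $ i\<close>; over finitely many it is attained.\<close>
    have ne: "?S \<noteq> {}" using x[of i] by (auto simp: top_ereal_def)
    have fin: "finite ?S" by simp
    have "Inf ?S \<in> ?S" using Min_in[OF fin ne] unfolding Min_Inf[OF fin ne] .
    then obtain k where k: "k < length V" "ereal (x $ i) = V ! k $ i + ereal (t k)"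
      using x[of i] by auto
    then have r: "V ! k $ i = ereal (x $ i - t k)" by (cases "V ! k $ i") auto
    have "ereal (x $ l - x $ i + (x $ i - t k)) \<le> V ! k $ l" for l
      using le[OF k(1), of l] by (cases "V ! k $ l") auto
    with r have "hits (V ! k) i x" unfolding hits_def by blast
    with k(1) show "\<exists>v\<in>set V. hits v i x" by auto
  qed
next
  assume hit: "\<forall>i. \<exists>v\<in>set V. hits v i x"
  have "\<exists>t. \<forall>k<length V. (\<forall>l. ereal (x $ l) \<le> V ! k $ l + ereal (t k)) \<and>
      (\<forall>i. hits (V ! k) i x \<longrightarrow> V ! k $ i + ereal (t k) = ereal (x $ i))"
    using V nth_mem by (intro choice_iff'[THEN iffD1] allI impI hits_residuum) blast
  then obtain t where t: "\<And>k l. k < length V \<Longrightarrow> ereal (x $ l) \<le> V ! k $ l + ereal (t k)"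
      "\<And>k i. k < length V \<Longrightarrow> hits (V ! k) i x \<Longrightarrow> V ! k $ i + ereal (t k) = ereal (x $ i)"
    by blast
  have "(INF k\<in>{..<length V}. V ! k $ i + ereal (t k)) = ereal (x $ i)" for i
  proof (rule antisym)
    obtain k where "k < length V" "hits (V ! k) i x" using hit by (metis in_set_conv_nth)
    then show "(INF k\<in>{..<length V}. V ! k $ i + ereal (t k)) \<le> ereal (x $ i)"
      using t(2) by (intro INF_lower2[of k]) auto
    show "ereal (x $ i) \<le> (INF k\<in>{..<length V}. V ! k $ i + ereal (t k))"
      using t(1) by (intro INF_greatest) auto
  qed
  then show "x \<in> tconv V" unfolding tconv_def trop_mult_def by (auto intro!: exI[of _ t])
qed

section \<open>Columns of a Kleene star as generators\<close>

lemma hits_column_self: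
  assumes "kleene_star c" "x \<in> alcove c"
  shows "hits (column c i) i x"
  using alcoveD[OF assms(2)] kleene_star_refl[OF assms(1)]
  by (auto simp: hits_def zero_ereal_def intro!: exI[of _ 0])

text \<open>By the triangle inequality the bounds that column \<open>k\<close> imposes at
  \<open>i\<close> imply those of column \<open>i\<close>. So whichever column hits \<open>x\<close>
  at \<open>i\<close>, column \<open>i\<close> does too.\<close>

lemma hits_column_bound:
  assumes c: "kleene_star c" and h: "hits (column c k) i x"
  shows "ereal (x $ l - x $ i) \<le> c l i"
proof (cases "c l i")
  case (real s)
  obtain r where r: "c i k = ereal r" "ereal (x $ l - x $ i + r) \<le> c l k"
    using h by (auto simp: hits_def)
  have "c l k \<le> ereal (s + r)" by (rule kleene_star_triangle[OF c, of l i s k r]) (use r real in auto)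
  with r(2) have "ereal (x $ l - x $ i + r) \<le> ereal (s + r)" by (rule order_trans)
  then show ?thesis using real by simp
qed (use kleene_star_not_minf[OF c, of l i] in auto)

lemma alcove_subset_tconv:
  assumes c: "kleene_star c" and V: "\<And>v i. v \<in> set V \<Longrightarrow> v $ i \<noteq> -\<infinity>"
    and cols: "\<And>j. \<exists>v\<in>set V. \<exists>t. \<forall>i. v $ i = c i j + ereal t"
  shows "alcove c \<subseteq> tconv V"
proof
  fix x assume x: "x \<in> alcove c"
  have "\<exists>v\<in>set V. hits v i x" for i
  proof -
    obtain v t where v: "v \<in> set V" "\<And>l. v $ l = column c i $ l + ereal t" using cols[of i] by auto
    then show ?thesis using hits_shift[OF v(2) hits_column_self[OF c x]] by blast
  qed
  then show "x \<in> tconv V" using mem_tconv_iff[OF V] by blast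
qed

lemma tconv_columns:
  assumes c: "kleene_star c" and js: "set js = UNIV"
  shows "tconv (map (column c) js) = alcove c"
proof
  have V: "v $ i \<noteq> -\<infinity>" if "v \<in> set (map (column c) js)" for v i
    using that kleene_star_not_minf[OF c] by auto
  show "alcove c \<subseteq> tconv (map (column c) js)"
  proof (rule alcove_subset_tconv[OF c V])
    show "\<exists>v\<in>set (map (column c) js). \<exists>t. \<forall>i. v $ i = c i j + ereal t" for j
      using js by (intro bexI[of _ "column c j"] exI[of _ 0]) auto
  qed
  show "tconv (map (column c) js) \<subseteq> alcove c"
  proof
    fix x assume "x \<in> tconv (map (column c) js)"
    then have "\<forall>i. \<exists>v\<in>set (map (column c) js). hits v i x" using mem_tconv_iff[OF V] by blast
    then have "\<exists>k. hits (column c k) i x" for i by auto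
    then show "x \<in> alcove c" using hits_column_bound[OF c] by (blast intro: alcoveI)
  qed
qed

lemma trop_config_columns:
  assumes c: "kleene_star c" and js: "set js = UNIV"
  shows "trop_config (map (column c) js)"
proof -
  have "\<exists>k<length js. js ! k = i" for i using js by (metis UNIV_I in_set_conv_nth)
  then have "\<exists>k<length js. c i (js ! k) \<noteq> \<infinity>" for i
    using kleene_star_refl[OF c, of i] by (metis PInfty_neq_ereal(1) zero_ereal_def)
  moreover have "\<exists>i. c i j \<noteq> \<infinity>" for j using kleene_star_refl[OF c, of j] by (intro exI[of _ j]) auto
  moreover have "map (column c) js ! k $ i = c i (js ! k)" if "k < length js" for i k
    using that by simp
  ultimately show ?thesis
    unfolding trop_config_def length_map using kleene_star_not_minf[OF c]
    by (intro conjI allI impI) (force+)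
qed

section \<open>Convexity and dimension of alcoves\<close>

lemma convex_alcove:
  fixes c :: "'n::finite \<Rightarrow> 'n \<Rightarrow> ereal"
  shows "convex (alcove c)"
proof -
  have "convex {x::real^'n. ereal (x $ i - x $ j) \<le> c i j}" for i j :: 'n
  proof (cases "c i j")
    case (real r)
    have "{x::real^'n. ereal (x $ i - x $ j) \<le> c i j} = {x. (axis i 1 - axis j 1) \<bullet> x \<le> r}"
      using real by (auto simp: inner_diff_left inner_axis')
    then show ?thesis by (simp add: convex_halfspace_le)
  qed auto
  then have "convex (\<Inter>i. \<Inter>j. {x::real^'n. ereal (x $ i - x $ j) \<le> c i j})"
    by (intro convex_INT)
  moreover have "alcove c = (\<Inter>i. \<Inter>j. {x. ereal (x $ i - x $ j) \<le> c i j})"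
    by (auto simp: alcove_def feasible_def)
  ultimately show ?thesis by simp
qed

lemma aff_dim_alcove:
  fixes c :: "'n::finite \<Rightarrow> 'n \<Rightarrow> ereal"
  assumes c: "strict_star c"
  shows "aff_dim (alcove c) = int CARD('n)"
proof -
  define U where "U = (\<Inter>i. \<Inter>j\<in>-{i}. {x::real^'n. ereal (x $ i - x $ j) < c i j})"
  have "open {x::real^'n. ereal (x $ i - x $ j) < c i j}" for i j
    by (intro open_Collect_less continuous_intros continuous_on_ereal)
  then have "open U" unfolding U_def by (intro open_INT) auto
  moreover obtain w where w: "w \<in> alcove c" "\<And>i j. i \<noteq> j \<Longrightarrow> ereal (w $ i - w $ j) < c i j"
    using strict_star_interior[OF c] by blast
  then have "w \<in> U" by (auto simp: U_def)
  then have "U \<noteq> {}" by blast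
  ultimately have "aff_dim U = int CARD('n)" by (simp add: aff_dim_open)
  moreover have "U \<subseteq> alcove c"
  proof
    fix x assume x: "x \<in> U"
    show "x \<in> alcove c"
    proof (rule alcoveI)
      fix i j show "ereal (x $ i - x $ j) \<le> c i j"
        using x kleene_star_refl[OF strict_star_kleene[OF c], of i]
        by (cases "i = j") (auto simp: U_def zero_ereal_def less_imp_le)
    qed
  qed
  ultimately show ?thesis
    using aff_dim_subset[of U "alcove c"] aff_dim_le_DIM[of "alcove c"] by simp
qed

text \<open>If \<open>c i j + c j i \<le> 0\<close>, the two opposite inequalities confine the
  alcove to a hyperplane.\<close>

lemma full_dim_strict:
  fixes c :: "'n::finite \<Rightarrow> 'n \<Rightarrow> ereal"
  assumes c: "kleene_star c" and dim: "aff_dim (alcove c) = int CARD('n)"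
  shows "strict_star c"
proof -
  have "0 < c i j + c j i" if "i \<noteq> j" for i j
  proof (rule ccontr)
    assume "\<not> 0 < c i j + c j i"
    then obtain a b where ab: "c i j = ereal a" "c j i = ereal b" "a + b \<le> 0"
      using kleene_star_not_minf[OF c, of i j] kleene_star_not_minf[OF c, of j i]
      by (cases "c i j"; cases "c j i") (auto simp: zero_ereal_def)
    have "alcove c \<subseteq> {x. (axis i 1 - axis j 1) \<bullet> x = a}"
    proof
      fix x assume "x \<in> alcove c"
      then show "x \<in> {x. (axis i 1 - axis j 1) \<bullet> x = a}"
        using alcoveD[of x c i j] alcoveD[of x c j i] ab by (simp add: inner_diff_left inner_axis')
    qed
    then have "aff_dim (alcove c) \<le> aff_dim {x::real^'n. (axis i 1 - axis j 1) \<bullet> x = a}"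
      by (rule aff_dim_subset)
    moreover have "axis i 1 - axis j 1 \<noteq> (0::real^'n)" using that by (auto simp: axis_eq_axis)
    ultimately show False using dim by (simp add: aff_dim_hyperplane)
  qed
  with c show ?thesis by (simp add: strict_star_def)
qed

section \<open>Convex tropical hulls are alcoves\<close>

lemma truncate_in_tconv:
  assumes V: "\<And>v i. v \<in> set V \<Longrightarrow> v $ i \<noteq> -\<infinity>" and p: "p \<in> tconv V"
    and v: "v \<in> set V" "\<And>i. v $ i = u $ i + ereal t"
  shows "truncate u p T \<in> tconv V"
proof -
  have u: "u $ i \<noteq> -\<infinity>" for i using V[OF v(1), of i] v(2)[of i] by auto
  define x where "x = truncate u p T"
  have x: "ereal (x $ i) = min (u $ i) (ereal (p $ i + T))" for i
    unfolding x_def by (rule truncate_nth[OF u])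
  \<comment> \<open>Where \<open>u\<close> is the smaller of \<open>u\<close> and
    \<open>p + T\<close>, its shift \<open>v\<close> hits \<open>x\<close>. Elsewhere the generator
    that hits \<open>p\<close> also hits \<open>x\<close>, since \<open>x\<close> lies below
    \<open>p + T\<close> and meets it at \<open>i\<close>.\<close>
  have "\<exists>v\<in>set V. hits v i x" for i
  proof (cases "u $ i \<le> ereal (p $ i + T)")
    case True
    then have "u $ i = ereal (x $ i)" using x[of i] by (simp add: min_def)
    moreover have "ereal (x $ l) \<le> u $ l" for l unfolding x by simp
    ultimately have "hits u i x" by (auto simp: hits_def)
    then show ?thesis using hits_shift[OF v(2)] v(1) by blast
  next
    case False
    then have i: "x $ i = p $ i + T" using x[of i] by (simp add: min_def)
    obtain v' r where v': "v' \<in> set V" "v' $ i = ereal r" "\<And>l. ereal (p $ l - p $ i + r) \<le> v' $ l"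
      using p mem_tconv_iff[OF V] by (fastforce simp: hits_def)
    have "ereal (x $ l - x $ i + r) \<le> v' $ l" for l
    proof -
      have "ereal (x $ l) \<le> ereal (p $ l + T)" unfolding x by simp
      then have "ereal (x $ l - x $ i + r) \<le> ereal (p $ l - p $ i + r)" using i by simp
      then show ?thesis using v'(3)[of l] by (rule order_trans)
    qed
    then show ?thesis using v' by (auto simp: hits_def)
  qed
  then show ?thesis using mem_tconv_iff[OF V] unfolding x_def by blast
qed

text \<open>If \<open>b + d\<close> is a real \<open>r\<close>, any \<open>T > r - q\<close> makes
  the truncation of \<open>a\<close> inactive, because the right-hand side never exceeds
  \<open>r\<close>.\<close>

lemma le_of_truncations:
  assumes "\<And>T. min a (ereal (q + T)) \<le> b + min d (ereal (s + T))" "a \<noteq> -\<infinity>" "b \<noteq> -\<infinity>" "d \<noteq> -\<infinity>"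
  shows "a \<le> b + d"
proof (cases "b + d")
  case (real r)
  have "min a (ereal (q + (\<bar>r - q\<bar> + 1))) \<le> b + d"
    by (rule order_trans[OF assms(1) add_left_mono]) simp
  moreover have "\<not> ereal (q + (\<bar>r - q\<bar> + 1)) \<le> b + d" using real by simp
  ultimately show ?thesis by (auto simp: min_le_iff_disj)
qed (use assms(2-) in \<open>cases b; cases d; auto\<close>)+

text \<open>After normalising to \<open>u\<^sub>j = 0\<close>, every point of the polytrope \<open>P\<close> lies below some generator.
  A maximal generator \<open>u\<close> dominates all of \<open>P\<close>: if \<open>y \<in> P\<close> had \<open>y\<^sub>k > u\<^sub>k\<close>, then the points
  close to \<open>u\<close> on the segment from \<open>u\<close> to \<open>y\<close> could lie below no generator.\<close>

lemma dominating_generator: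
  fixes V :: "(ereal^'n) list"
  assumes V: "trop_config V" and conv: "convex (tconv V)" and p: "p \<in> tconv V"
  obtains u v t where "v \<in> set V" "\<And>i. v $ i = u $ i + ereal t" "u $ j = 0"
    "\<And>y i. y \<in> tconv V \<Longrightarrow> ereal (y $ i - y $ j) \<le> u $ i"
proof -
  have V': "v $ i \<noteq> -\<infinity>" if "v \<in> set V" for v i
    using that V by (auto simp: trop_config_def in_set_conv_nth)
  define M where "M = (\<lambda>v. \<chi> i. v $ i - v $ j) ` {v \<in> set V. v $ j \<noteq> \<infinity>}"
  have M_shift: "\<exists>v\<in>set V. \<exists>t. \<forall>i. v $ i = u $ i + ereal t" and M_j: "u $ j = 0" if u: "u \<in> M" for u
  proof -
    obtain v where v: "v \<in> set V" "v $ j \<noteq> \<infinity>" "u = (\<chi> i. v $ i - v $ j)"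
      using u by (auto simp: M_def)
    obtain r where r: "v $ j = ereal r" using v V' by (metis ereal_cases)
    have "v $ i = u $ i + ereal r" for i
      unfolding v(3) using r by (cases "v $ i") auto
    with v(1) show "\<exists>v\<in>set V. \<exists>t. \<forall>i. v $ i = u $ i + ereal t" by blast
    show "u $ j = 0" unfolding v(3) using r by (simp add: zero_ereal_def)
  qed
  have M_notminf: "u $ i \<noteq> -\<infinity>" if "u \<in> M" for u i
    using M_shift[OF that] V' by fastforce
  have M_above: "\<exists>u\<in>M. \<forall>i. ereal (x $ i - x $ j) \<le> u $ i" if "x \<in> tconv V" for x
  proof -
    obtain v r where v: "v \<in> set V" "v $ j = ereal r" "\<And>i. ereal (x $ i - x $ j + r) \<le> v $ i"
      using \<open>x \<in> tconv V\<close> mem_tconv_iff[OF V'] unfolding hits_def by blast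
    have "ereal (x $ i - x $ j) \<le> v $ i - v $ j" for i
      using v(3)[of i] v(2) by (cases "v $ i") auto
    with v show ?thesis unfolding M_def by force
  qed
  have "finite M" unfolding M_def by simp
  moreover have "M \<noteq> {}" using M_above[OF p] by blast
  ultimately obtain u where u: "u \<in> M" and u_max: "\<And>u'. u' \<in> M \<Longrightarrow> u \<le> u' \<Longrightarrow> u' = u"
    using finite_has_maximal[of M] by metis
  obtain v t where v: "v \<in> set V" "\<And>i. v $ i = u $ i + ereal t" using M_shift[OF u] by blast
  have "ereal (y $ k - y $ j) \<le> u $ k" if y: "y \<in> tconv V" for y k
  proof (rule ccontr)
    assume less: "\<not> ereal (y $ k - y $ j) \<le> u $ k"
    then obtain s where s: "u $ k = ereal s" using M_notminf[OF u, of k] by (cases "u $ k") auto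
    \<comment> \<open>\<open>u\<close> may have infinite entries, so a truncation with large
      \<open>T\<close> stands in for it. It still exceeds, in some coordinate, every normalised
      generator not above \<open>u\<close>, and it agrees with \<open>u\<close> at \<open>j\<close>
      and \<open>k\<close>.\<close>
    define x where "x T = truncate u p T" for T
    have x: "ereal (x T $ i) = min (u $ i) (ereal (p $ i + T))" for T i
      unfolding x_def by (rule truncate_nth[OF M_notminf[OF u]])
    have "\<forall>\<^sub>F T in at_top. \<exists>i. u' $ i < ereal (x T $ i)" if u': "u' \<in> M" "\<not> u \<le> u'" for u'
    proof -
      obtain i where i: "u' $ i < u $ i" using u'(2) by (auto simp: less_eq_vec_def not_le)
      then obtain a where a: "u' $ i = ereal a" using M_notminf[OF u'(1), of i] by (cases "u' $ i") auto
      have "\<forall>\<^sub>F T in at_top. a - p $ i < T" by (rule eventually_gt_at_top)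
      then show ?thesis
      proof eventually_elim
        case (elim T)
        then show ?case using i a x[of T i] by (intro exI[of _ i]) (auto simp: min_def)
      qed
    qed
    then have "\<forall>\<^sub>F T in at_top. \<forall>u'\<in>{u' \<in> M. \<not> u \<le> u'}. \<exists>i. u' $ i < ereal (x T $ i)"
      using \<open>finite M\<close> by (intro eventually_ball_finite) auto
    then have "\<forall>\<^sub>F T in at_top. (\<forall>u'\<in>{u' \<in> M. \<not> u \<le> u'}. \<exists>i. u' $ i < ereal (x T $ i)) \<and>
        s - p $ k < T \<and> - p $ j < T"
      by (intro eventually_conj eventually_gt_at_top)
    from eventually_happens'[OF trivial_limit_at_top_linorder this]
    obtain T where T: "\<And>u'. u' \<in> M \<Longrightarrow> \<not> u \<le> u' \<Longrightarrow> \<exists>i. u' $ i < ereal (x T $ i)"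
        "s - p $ k < T" "- p $ j < T"
      by blast
    have xk: "x T $ k = s" using x[of T k] s T(2) by (simp add: min_def)
    have xj: "x T $ j = 0" using x[of T j] M_j[OF u] T(3) by (auto simp: min_def zero_ereal_def split: if_splits)
    \<comment> \<open>A short way along the segment those strict inequalities persist, so only
      \<open>u\<close> itself can lie above \<open>z e\<close>, normalised as \<open>b e\<close>. At
      \<open>k\<close> this would bound a proper average of \<open>s\<close> and a larger number by
      \<open>s\<close>.\<close>
    define z where "z e = (1 - e) *\<^sub>R x T + e *\<^sub>R y" for e :: real
    define b where "b e i = z e $ i - e * y $ j" for e i
    have b: "b e i = (1 - e) * x T $ i + e * (y $ i - y $ j)" for e i
      by (simp add: b_def z_def algebra_simps)
    have "\<forall>\<^sub>F e in at_right 0. \<exists>i. u' $ i < ereal (b e i)" if u': "u' \<in> {u' \<in> M. \<not> u \<le> u'}" for u'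
    proof -
      obtain i where i: "u' $ i < ereal (x T $ i)" using u' T(1) by blast
      have "((\<lambda>e. ereal (b e i)) \<longlongrightarrow> ereal ((1 - 0) * x T $ i + 0 * (y $ i - y $ j))) (at_right 0)"
        unfolding b by (intro tendsto_intros)
      then have "\<forall>\<^sub>F e in at_right 0. u' $ i < ereal (b e i)"
        using i by (intro order_tendstoD) auto
      then show ?thesis by eventually_elim blast
    qed
    then have "\<forall>\<^sub>F e in at_right 0. \<forall>u'\<in>{u' \<in> M. \<not> u \<le> u'}. \<exists>i. u' $ i < ereal (b e i)"
      using \<open>finite M\<close> by (intro eventually_ball_finite) auto
    moreover have "\<forall>\<^sub>F e in at_right 0. e \<in> {0<..<1::real}"
      by (rule eventually_at_right_real) simp
    ultimately have "\<forall>\<^sub>F e in at_right 0. (\<forall>u'\<in>{u' \<in> M. \<not> u \<le> u'}. \<exists>i. u' $ i < ereal (b e i)) \<and> e \<in> {0<..<1}"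
      by (rule eventually_conj)
    from eventually_happens'[OF trivial_limit_at_right_real this]
    obtain e where e: "\<And>u'. u' \<in> M \<Longrightarrow> \<not> u \<le> u' \<Longrightarrow> \<exists>i. u' $ i < ereal (b e i)" "0 < e" "e < 1"
      by auto
    have "x T \<in> tconv V" unfolding x_def by (rule truncate_in_tconv[OF V' p v])
    then have "z e \<in> tconv V"
      unfolding z_def using conv y e(2,3) by (auto intro: convexD)
    then obtain u' where u': "u' \<in> M" "\<And>i. ereal (z e $ i - z e $ j) \<le> u' $ i" using M_above by blast
    have "z e $ j = e * y $ j" by (simp add: z_def xj)
    then have le: "ereal (b e i) \<le> u' $ i" for i using u'(2)[of i] by (simp add: b_def)
    have "u \<le> u'" using e(1)[OF u'(1)] le by (meson not_le)
    then have "u' = u" using u'(1) u_max by blast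
    then have "b e k \<le> s" using le[of k] s by simp
    then have "e * (y $ k - y $ j - s) \<le> 0" unfolding b xk by (simp add: algebra_simps)
    then show False using less s e(2) by (simp add: mult_le_0_iff)
  qed
  then show ?thesis using that[OF v M_j[OF u]] by blast
qed

text \<open>Column \<open>j\<close> is the dominating generator normalised at \<open>j\<close>:
  domination puts the hull inside the alcove, and being a shifted generator gives the converse. The
  triangle inequality holds because truncations of column \<open>j\<close> are points of the hull
  and so obey the bounds of column \<open>k\<close>.\<close>

lemma convex_tconv_is_alcove:
  fixes V :: "(ereal^'n) list"
  assumes V: "trop_config V" and conv: "convex (tconv V)" and ne: "tconv V \<noteq> {}"
  obtains c where "kleene_star c" "tconv V = alcove c"
proof -
  have V': "v $ i \<noteq> -\<infinity>" if "v \<in> set V" for v i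
    using that V by (auto simp: trop_config_def in_set_conv_nth)
  obtain p where p: "p \<in> tconv V" using ne by blast
  have "\<exists>u. (\<exists>v\<in>set V. \<exists>t. \<forall>i. v $ i = u $ i + ereal t) \<and> u $ j = 0 \<and>
      (\<forall>y\<in>tconv V. \<forall>i. ereal (y $ i - y $ j) \<le> u $ i)" for j
    by (rule dominating_generator[OF V conv p, of j]) blast
  then have "\<exists>u. \<forall>j. (\<exists>v\<in>set V. \<exists>t. \<forall>i. v $ i = u j $ i + ereal t) \<and> u j $ j = 0 \<and>
      (\<forall>y\<in>tconv V. \<forall>i. ereal (y $ i - y $ j) \<le> u j $ i)"
    by (intro choice allI)
  then obtain u where u: "\<And>j. \<exists>v\<in>set V. \<exists>t. \<forall>i. v $ i = u j $ i + ereal t" "\<And>j. u j $ j = 0"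
      "\<And>j y i. y \<in> tconv V \<Longrightarrow> ereal (y $ i - y $ j) \<le> u j $ i"
    by blast
  define c where "c i j = u j $ i" for i j
  have notminf: "c i j \<noteq> -\<infinity>" for i j using u(1)[of j] V' by (fastforce simp: c_def)
  have "c i j \<le> c i k + c k j" for i j k
  proof (rule le_of_truncations)
    fix T
    obtain v t where v: "v \<in> set V" "\<And>i. v $ i = u j $ i + ereal t" using u(1) by blast
    define x where "x = truncate (u j) p T"
    have x: "ereal (x $ i) = min (c i j) (ereal (p $ i + T))" for i
      unfolding x_def c_def using notminf[unfolded c_def] by (rule truncate_nth)
    have "x \<in> tconv V" unfolding x_def by (rule truncate_in_tconv[OF V' p v])
    then have "ereal (x $ i - x $ k) \<le> c i k" using u(3) by (simp add: c_def)
    then have "ereal (x $ i) \<le> c i k + ereal (x $ k)" by (cases "c i k") auto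
    then show "min (c i j) (ereal (p $ i + T)) \<le> c i k + min (c k j) (ereal (p $ k + T))"
      by (simp add: x)
  qed (use notminf in auto)
  then have c: "kleene_star c" unfolding kleene_star_def using notminf u(2) by (auto simp: c_def)
  have "tconv V \<subseteq> alcove c" using u(3) by (auto intro: alcoveI simp: c_def)
  moreover have "alcove c \<subseteq> tconv V"
    by (rule alcove_subset_tconv[OF c V']) (use u(1) in \<open>auto simp: c_def\<close>)
  ultimately show ?thesis using c that by blast
qed

lemma obtain_enumeration:
  obtains js where "distinct js" "set js = (UNIV :: 'n::finite set)"
  using finite_distinct_list[OF finite] by blast

lemma full_dim_polytropes_eq:
  "full_dim_polytropes = alcove ` {c :: 'n::finite \<Rightarrow> 'n \<Rightarrow> ereal. strict_star c}"
proof (intro equalityI subsetI)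
  fix P :: "(real^'n) set" assume "P \<in> full_dim_polytropes"
  then obtain V where V: "trop_config V" "P = tconv V" "convex (tconv V)" "aff_dim P = int CARD('n)"
    by (auto simp: full_dim_polytropes_def polytrope_def)
  have "tconv V \<noteq> {}"
  proof
    assume "tconv V = {}"
    then show False using V(2,4) by simp
  qed
  then obtain c where c: "kleene_star c" "tconv V = alcove c"
    by (rule convex_tconv_is_alcove[OF V(1,3)])
  then have "strict_star c" using V(2,4) full_dim_strict by metis
  with V(2) c(2) show "P \<in> alcove ` {c. strict_star c}" by blast
next
  fix P :: "(real^'n) set" assume "P \<in> alcove ` {c. strict_star c}"
  then obtain c where c: "strict_star c" "P = alcove c" by blast
  obtain js where js: "set js = (UNIV::'n set)" using obtain_enumeration by blast
  note k = strict_star_kleene[OF c(1)]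
  show "P \<in> full_dim_polytropes"
    unfolding full_dim_polytropes_def polytrope_def c(2)
    using convex_alcove aff_dim_alcove[OF c(1)] tconv_columns[OF k js] trop_config_columns[OF k js]
    by blast
qed

section \<open>Irredundant generators\<close>

lemma generator_below_column:
  assumes V: "\<And>v i. v \<in> set V \<Longrightarrow> v $ i \<noteq> -\<infinity>" and c: "kleene_star c"
    and eq: "tconv V = alcove c" and v: "v \<in> set V"
  shows "v $ i \<le> c i j + v $ j"
proof -
  obtain p where p: "p \<in> alcove c" using c by (rule alcove_nonempty)
  show ?thesis
  proof (rule le_of_truncations)
    fix T
    define x where "x = truncate v p T"
    have x: "ereal (x $ i) = min (v $ i) (ereal (p $ i + T))" for i
      unfolding x_def using V[OF v] by (rule truncate_nth)
    have "x \<in> tconv V" unfolding x_def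
      by (rule truncate_in_tconv[OF V _ v, of p v 0]) (use p eq in auto)
    then have "ereal (x $ i - x $ j) \<le> c i j" using eq alcoveD by metis
    then have "ereal (x $ i) \<le> c i j + ereal (x $ j)" by (cases "c i j") auto
    then show "min (v $ i) (ereal (p $ i + T)) \<le> c i j + min (v $ j) (ereal (p $ j + T))"
      by (simp add: x)
  qed (use V[OF v] kleene_star_not_minf[OF c] in auto)
qed

text \<open>Column \<open>j\<close> is extreme. Its truncations lie in the hull, so some generator
  hits them at \<open>j\<close>; normalised there, it lies above the truncation, and by
  \<open>generator_below_column\<close> below the column. Since there are finitely many generators,
  one large \<open>T\<close> excludes all that differ from the column.\<close>

lemma columns_among_generators:
  assumes V: "\<And>v i. v \<in> set V \<Longrightarrow> v $ i \<noteq> -\<infinity>" and c: "kleene_star c"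
    and eq: "tconv V = alcove c"
  shows "\<exists>v\<in>set V. \<exists>t. \<forall>i. v $ i = c i j + ereal t"
proof (rule ccontr)
  assume no: "\<not> ?thesis"
  obtain p where p: "p \<in> alcove c" using c by (rule alcove_nonempty)
  define x where "x T = truncate (column c j) p T" for T
  have x: "ereal (x T $ i) = min (c i j) (ereal (p $ i + T))" for T i
    unfolding x_def using truncate_nth[of "column c j" i p T] kleene_star_not_minf[OF c] by simp
  have x_in: "x T \<in> tconv V" for T unfolding x_def eq by (rule truncated_column_in_alcove[OF c p])
  have "\<forall>\<^sub>F T in at_top. \<exists>i. v $ i < ereal (x T $ i) + v $ j"
    if v: "v \<in> {v \<in> set V. v $ j \<noteq> \<infinity>}" for v
  proof -
    obtain r where r: "v $ j = ereal r" using v V by (metis (mono_tags) ereal_cases mem_Collect_eq)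
    obtain i where "v $ i \<noteq> c i j + ereal r" using no v by blast
    moreover have "v $ i \<le> c i j + ereal r"
      using generator_below_column[OF V c eq, of v i j] v r by simp
    ultimately have less: "v $ i < c i j + ereal r" by simp
    then obtain a where a: "v $ i = ereal a" using V[of v i] v by (cases "v $ i") auto
    have "\<forall>\<^sub>F T in at_top. a - r - p $ i < T" by (rule eventually_gt_at_top)
    then show ?thesis
    proof eventually_elim
      case (elim T)
      have "ereal (a - r) < c i j" using less a by (cases "c i j") auto
      with elim have "ereal (a - r) < ereal (x T $ i)" unfolding x by simp
      then show ?case using a r by (intro exI[of _ i]) auto
    qed
  qed
  then have "\<forall>\<^sub>F T in at_top. \<forall>v\<in>{v \<in> set V. v $ j \<noteq> \<infinity>}. \<exists>i. v $ i < ereal (x T $ i) + v $ j"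
    by (intro eventually_ball_finite) auto
  then have "\<forall>\<^sub>F T in at_top. (\<forall>v\<in>{v \<in> set V. v $ j \<noteq> \<infinity>}. \<exists>i. v $ i < ereal (x T $ i) + v $ j) \<and> - p $ j < T"
    by (intro eventually_conj eventually_gt_at_top)
  from eventually_happens'[OF trivial_limit_at_top_linorder this]
  obtain T where T: "\<And>v. v \<in> set V \<Longrightarrow> v $ j \<noteq> \<infinity> \<Longrightarrow> \<exists>i. v $ i < ereal (x T $ i) + v $ j" "- p $ j < T"
    by blast
  have xj: "x T $ j = 0"
    using x[of T j] kleene_star_refl[OF c, of j] T(2) by (auto simp: min_def zero_ereal_def split: if_splits)
  obtain v r where v: "v \<in> set V" "v $ j = ereal r" "\<And>l. ereal (x T $ l - x T $ j + r) \<le> v $ l"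
    using x_in[of T] mem_tconv_iff[OF V] unfolding hits_def by blast
  obtain i where "v $ i < ereal (x T $ i) + v $ j" using T(1)[OF v(1)] v(2) by auto
  then show False using v(3)[of i] v(2) xj by simp
qed

lemma strict_columns_not_shifts:
  assumes c: "strict_star c" and a: "\<And>i. v $ i = c i j + ereal s" and b: "\<And>i. v $ i = c i k + ereal t"
  shows "j = k"
proof (rule ccontr)
  assume "j \<noteq> k"
  have "c j k + ereal t = ereal s" "c k j + ereal s = ereal t"
    using a[of j] b[of j] a[of k] b[of k] kleene_star_refl[OF strict_star_kleene[OF c]] by auto
  then have "c j k + c k j = 0"
    by (cases "c j k"; cases "c k j") (auto simp: zero_ereal_def)
  moreover have "0 < c j k + c k j" using c \<open>j \<noteq> k\<close> unfolding strict_star_def by blast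
  ultimately show False by simp
qed

text \<open>\<open>irredundant\<close> deletes a position, not a value: a generator listed twice
  survives the deletion, so the remaining set is described by positions.\<close>

lemma set_remove_nth:
  "k < length V \<Longrightarrow> set (take k V @ drop (Suc k) V) = (!) V ` ({..<length V} - {k})"
proof (intro equalityI subsetI)
  fix v assume k: "k < length V" and v: "v \<in> set (take k V @ drop (Suc k) V)"
  then consider "v \<in> set (take k V)" | "v \<in> set (drop (Suc k) V)" by auto
  then show "v \<in> (!) V ` ({..<length V} - {k})"
  proof cases
    case 1
    then obtain i where "i < length (take k V)" "v = take k V ! i" by (metis in_set_conv_nth)
    with k show ?thesis by (intro image_eqI[of _ _ i]) auto
  next
    case 2
    then obtain i where "i < length (drop (Suc k) V)" "v = drop (Suc k) V ! i" by (metis in_set_conv_nth)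
    with k show ?thesis by (intro image_eqI[of _ _ "Suc k + i"]) auto
  qed
next
  fix v assume k: "k < length V" and "v \<in> (!) V ` ({..<length V} - {k})"
  then obtain i where i: "i < length V" "i \<noteq> k" "v = V ! i" by auto
  show "v \<in> set (take k V @ drop (Suc k) V)"
  proof (cases "i < k")
    case True
    then have "v = take k V ! i" "i < length (take k V)" using i by auto
    then show ?thesis by (auto simp del: length_take)
  next
    case False
    then have "v = drop (Suc k) V ! (i - Suc k)" "i - Suc k < length (drop (Suc k) V)" using i by auto
    then have "v \<in> set (drop (Suc k) V)" by (metis nth_mem)
    then show ?thesis by simp
  qed
qed

definition generated_by :: "(ereal^'n) list \<Rightarrow> ('n \<Rightarrow> 'n \<Rightarrow> ereal) \<Rightarrow> (nat \<Rightarrow> 'n) \<Rightarrow> bool" where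
  "generated_by V c \<pi> \<longleftrightarrow> bij_betw \<pi> {..<length V} UNIV \<and>
     (\<forall>k<length V. \<exists>t. \<forall>i. V ! k $ i = c i (\<pi> k) + ereal t)"

text \<open>Each column sits at some position \<open>\<kappa> j\<close>, different columns at
  different positions because they are not shifts of each other. A position outside the range of
  \<open>\<kappa>\<close> could be deleted, as all columns would remain.\<close>

lemma irredundant_generators:
  fixes V :: "(ereal^'n) list"
  assumes V: "trop_config V" and irr: "irredundant V" and c: "strict_star c" and eq: "tconv V = alcove c"
  obtains \<pi> where "generated_by V c \<pi>"
proof -
  note k = strict_star_kleene[OF c]
  have V': "v $ i \<noteq> -\<infinity>" if "v \<in> set V" for v i
    using that V by (auto simp: trop_config_def in_set_conv_nth)
  have "\<exists>k<length V. \<exists>t. \<forall>i. V ! k $ i = c i j + ereal t" for j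
    using columns_among_generators[OF V' k eq, of j] by (metis in_set_conv_nth)
  then obtain \<kappa> where \<kappa>: "\<And>j. \<kappa> j < length V" "\<And>j. \<exists>t. \<forall>i. V ! \<kappa> j $ i = c i j + ereal t"
    by metis
  have inj: "inj \<kappa>"
  proof (rule injI)
    fix j j' assume "\<kappa> j = \<kappa> j'"
    then show "j = j'" using \<kappa>(2)[of j] \<kappa>(2)[of j'] strict_columns_not_shifts[OF c] by metis
  qed
  have "range \<kappa> = {..<length V}"
  proof (rule ccontr)
    assume "range \<kappa> \<noteq> {..<length V}"
    then obtain n where n: "n < length V" "n \<notin> range \<kappa>" using \<kappa>(1) by auto
    define W where "W = take n V @ drop (Suc n) V"
    have W: "set W = (!) V ` ({..<length V} - {n})" unfolding W_def using n(1) by (rule set_remove_nth)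
    have W': "v $ i \<noteq> -\<infinity>" if "v \<in> set W" for v i using that V' W by auto
    have "tconv W \<subseteq> tconv V"
    proof
      fix x assume "x \<in> tconv W"
      then have "\<forall>i. \<exists>v\<in>set W. hits v i x" using mem_tconv_iff[OF W'] by blast
      moreover have "set W \<subseteq> set V" using W by auto
      ultimately show "x \<in> tconv V" using mem_tconv_iff[OF V'] by blast
    qed
    moreover have "alcove c \<subseteq> tconv W"
    proof (rule alcove_subset_tconv[OF k W'])
      show "\<exists>v\<in>set W. \<exists>t. \<forall>i. v $ i = c i j + ereal t" for j
        using \<kappa>[of j] n(2) by (intro bexI[of _ "V ! \<kappa> j"]) (auto simp: W)
    qed
    ultimately have "tconv W = tconv V" using eq by simp
    then show False using irr n(1) by (simp add: irredundant_def W_def)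
  qed
  then have bij: "bij_betw \<kappa> UNIV {..<length V}" using inj by (simp add: bij_betw_def)
  have "generated_by V c (inv \<kappa>)"
    unfolding generated_by_def
  proof (intro conjI allI impI)
    show "bij_betw (inv \<kappa>) {..<length V} UNIV" using bij_betw_inv_into[OF bij] by simp
    show "\<exists>t. \<forall>i. V ! n $ i = c i (inv \<kappa> n) + ereal t" if "n < length V" for n
      using \<kappa>(2)[of "inv \<kappa> n"] that \<open>range \<kappa> = {..<length V}\<close> by (simp add: f_inv_into_f)
  qed
  then show ?thesis by (rule that)
qed

text \<open>The columns themselves, each listed once. If one could be dropped,
  \<open>columns_among_generators\<close> would find a shift of it among the others.\<close>

lemma obtain_irredundant_generators:
  fixes c :: "'n::finite \<Rightarrow> 'n \<Rightarrow> ereal"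
  assumes c: "strict_star c"
  obtains V where "trop_config V" "irredundant V" "tconv V = alcove c"
proof -
  note k = strict_star_kleene[OF c]
  obtain js where js: "distinct js" "set js = (UNIV::'n set)" using obtain_enumeration by blast
  define V where "V = map (column c) js"
  have V: "trop_config V" "tconv V = alcove c"
    unfolding V_def using trop_config_columns[OF k js(2)] tconv_columns[OF k js(2)] by auto
  have "irredundant V"
    unfolding irredundant_def
  proof (intro allI impI notI)
    fix n assume n: "n < length V" and eq: "tconv (take n V @ drop (Suc n) V) = tconv V"
    have W: "set (take n V @ drop (Suc n) V) = (!) V ` ({..<length V} - {n})"
      using n by (rule set_remove_nth)
    have "v $ i \<noteq> -\<infinity>" if "v \<in> set (take n V @ drop (Suc n) V)" for v i
      using that kleene_star_not_minf[OF k] unfolding W by (auto simp: V_def)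
    then obtain v t where v: "v \<in> set (take n V @ drop (Suc n) V)" "\<And>i. v $ i = c i (js ! n) + ereal t"
      using columns_among_generators[OF _ k eq[unfolded V(2)], of "js ! n"] by metis
    obtain m where m: "m < length V" "m \<noteq> n" "v = V ! m" using v(1) unfolding W by auto
    then have "v $ i = c i (js ! m) + ereal 0" for i by (simp add: V_def)
    then have "js ! m = js ! n" using strict_columns_not_shifts[OF c] v(2) by metis
    then show False using js(1) m n by (simp add: V_def nth_eq_iff_index_eq)
  qed
  with V show ?thesis using that by blast
qed

section \<open>Fundamental polytopes\<close>

definition root_vec :: "'n::finite \<Rightarrow> 'n \<Rightarrow> real^'n" where
  "root_vec i j = axis i 1 - axis j 1"

definition roots :: "('n::finite \<times> 'n) set \<Rightarrow> (real^'n) set" where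
  "roots F = (\<lambda>(j, i). root_vec i j) ` F"

text \<open>All loops stand for the origin, so \<open>edges C\<close> contains the whole diagonal or
  none of it.\<close>

definition edges :: "(real^'n::finite) set \<Rightarrow> ('n \<times> 'n) set" where
  "edges C = {(j, i). root_vec i j \<in> C}"

text \<open>The subdivision with height \<open>c i j\<close> at \<open>e_i - e_j\<close>:
  \<open>u\<close> is the slope and \<open>- b\<close> the constant term of a supporting affine
  function, merged into \<open>l = u + b\<close>.\<close>

definition star_subdivision :: "('n::finite \<Rightarrow> 'n \<Rightarrow> ereal) \<Rightarrow> (real^'n) set set" where
  "star_subdivision c = {convex hull (roots (tight c u l)) | u l.
     (\<exists>b. \<forall>j. l $ j = u $ j + b) \<and> feasible c u l \<and> tight c u l \<noteq> {}}"

lemma root_vec_self [simp]: "root_vec i i = 0"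
  by (simp add: root_vec_def)

lemma root_vec_uminus: "- root_vec i j = root_vec j i"
  by (simp add: root_vec_def)

lemma inner_root_vec [simp]: "u \<bullet> root_vec i j = u $ i - u $ j"
  by (simp add: root_vec_def inner_diff_right inner_axis)

lemma root_vec_nth: "root_vec i j $ k = (if i = k then 1 else 0) - (if j = k then 1 else 0)"
  by (simp add: root_vec_def axis_def)

lemma root_vec_eq_iff: "root_vec i j = root_vec k l \<longleftrightarrow> i = k \<and> j = l \<or> i = j \<and> k = l"
proof
  assume eq: "root_vec i j = root_vec k l"
  have "root_vec i j $ m = root_vec k l $ m" for m by (simp add: eq)
  from this[of i] this[of j] this[of k] this[of l]
  show "i = k \<and> j = l \<or> i = j \<and> k = l" by (auto simp: root_vec_nth split: if_splits)
qed auto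

lemma root_vec_eq_0_iff: "root_vec i j = 0 \<longleftrightarrow> i = j"
  using root_vec_eq_iff[of i j i i] by auto

text \<open>For \<open>i \<noteq> j\<close> the root \<open>e\<^sub>i - e\<^sub>j\<close> is the only root whose inner product with \<open>e\<^sub>i - e\<^sub>j\<close>
  exceeds \<open>1\<close>.\<close>

lemma root_vec_in_hull:
  assumes "root_vec i j \<in> convex hull (roots F)" and "i \<noteq> j"
  shows "(j, i) \<in> F"
proof (rule ccontr)
  assume notin: "(j, i) \<notin> F"
  have "convex hull (roots F) \<subseteq> {x. root_vec i j \<bullet> x \<le> 1}"
  proof (rule hull_minimal)
    show "roots F \<subseteq> {x. root_vec i j \<bullet> x \<le> 1}"
      using notin by (auto simp: roots_def root_vec_nth)
  qed (rule convex_halfspace_le)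
  with assms have "root_vec i j \<bullet> root_vec i j \<le> 1" by blast
  with assms(2) show False by (simp add: root_vec_nth)
qed

lemma zero_in_hull: "Id \<subseteq> F \<Longrightarrow> 0 \<in> convex hull (roots F)"
  by (rule hull_inc) (force simp: roots_def)

lemma edges_hull:
  assumes "Id \<subseteq> F"
  shows "edges (convex hull (roots F)) = F"
proof (intro equalityI subsetI)
  fix e assume "e \<in> edges (convex hull (roots F))"
  then show "e \<in> F" using root_vec_in_hull[of "snd e" "fst e" F] assms
    by (cases "fst e = snd e") (auto simp: edges_def)
next
  fix e assume "e \<in> F"
  then have "root_vec (snd e) (fst e) \<in> roots F" by (force simp: roots_def)
  then show "e \<in> edges (convex hull (roots F))" by (auto simp: edges_def hull_inc)
qed

section \<open>Cells as contact sets of affine functions\<close>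

lemma convex_hull_Int_supporting_hyperplane:
  fixes B :: "'a::euclidean_space set"
  assumes "finite B" and le: "\<And>p. p \<in> B \<Longrightarrow> n \<bullet> p \<le> b"
  shows "convex hull B \<inter> {p. n \<bullet> p = b} = convex hull (B \<inter> {p. n \<bullet> p = b})"
    and "(convex hull B \<inter> {p. n \<bullet> p = b}) face_of (convex hull B)"
proof -
  have "convex hull B \<subseteq> {p. n \<bullet> p \<le> b}"
    using le by (intro hull_minimal convex_halfspace_le) auto
  then show face: "(convex hull B \<inter> {p. n \<bullet> p = b}) face_of (convex hull B)"
    by (intro face_of_Int_supporting_hyperplane_le) auto
  obtain B' where B': "B' \<subseteq> B" "convex hull B \<inter> {p. n \<bullet> p = b} = convex hull B'"
    using face_of_convex_hull_subset[OF finite_imp_compact[OF assms(1)] face] by blast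
  have "B' \<subseteq> B \<inter> {p. n \<bullet> p = b}" using B' hull_subset[of B' convex] by blast
  then have "convex hull B' \<subseteq> convex hull (B \<inter> {p. n \<bullet> p = b})" by (rule hull_mono)
  moreover have "convex hull (B \<inter> {p. n \<bullet> p = b}) \<subseteq> convex hull B \<inter> {p. n \<bullet> p = b}"
    by (rule hull_minimal) (auto intro: hull_inc convex_Int convex_hyperplane)
  ultimately show "convex hull B \<inter> {p. n \<bullet> p = b} = convex hull (B \<inter> {p. n \<bullet> p = b})"
    using B'(2) by blast
qed

text \<open>Dividing the normal \<open>(u, c)\<close> by \<open>- c > 0\<close> gives it last
  coordinate \<open>-1\<close>. A lower face is then where an affine function touches the lifted
  points from below, and its projection is the hull of the contact points.\<close>

lemma induced_subdivision_eq:
  fixes A :: "'a::euclidean_space set"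
  assumes "finite A"
  shows "induced_subdivision A h = {convex hull {a \<in> A. u \<bullet> a - h a = b} | u b.
    (\<forall>a\<in>A. u \<bullet> a - h a \<le> b) \<and> (\<exists>a\<in>A. u \<bullet> a - h a = b)}" (is "_ = ?R")
proof -
  define B where "B = (\<lambda>a. (a, h a)) ` A"
  have "finite B" using assms by (simp add: B_def)
  have cell: "fst ` (convex hull B \<inter> {p. (u, - 1) \<bullet> p = b}) = convex hull {a \<in> A. u \<bullet> a - h a = b}"
    if "\<And>a. a \<in> A \<Longrightarrow> u \<bullet> a - h a \<le> b" for u b
  proof -
    have "convex hull B \<inter> {p. (u, - 1) \<bullet> p = b} = convex hull (B \<inter> {p. (u, - 1) \<bullet> p = b})"
      using that by (intro convex_hull_Int_supporting_hyperplane \<open>finite B\<close>) (auto simp: B_def)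
    then have "fst ` (convex hull B \<inter> {p. (u, - 1) \<bullet> p = b}) = convex hull (fst ` (B \<inter> {p. (u, - 1) \<bullet> p = b}))"
      using convex_hull_linear_image[OF linear_fst] by metis
    moreover have "fst ` (B \<inter> {p. (u, - 1) \<bullet> p = b}) = {a \<in> A. u \<bullet> a - h a = b}"
      by (force simp: B_def)
    ultimately show ?thesis by simp
  qed
  show ?thesis
  proof (intro equalityI subsetI)
    fix C assume "C \<in> induced_subdivision A h"
    then obtain u c b where c: "c < 0" and le: "convex hull B \<subseteq> {p. (u, c) \<bullet> p \<le> b}"
      and C: "C = fst ` (convex hull B \<inter> {p. (u, c) \<bullet> p = b})" and ne: "C \<noteq> {}"
      by (auto simp: induced_subdivision_def lower_face_def lifted_polytope_def B_def)
    define u' where "u' = (- 1 / c) *\<^sub>R u"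
    define b' where "b' = - b / c"
    have scale: "(u, c) \<bullet> p = b \<longleftrightarrow> (u', - 1) \<bullet> p = b'" "(u, c) \<bullet> p \<le> b \<longleftrightarrow> (u', - 1) \<bullet> p \<le> b'" for p
    proof -
      have "(u', - 1) \<bullet> p = (- 1 / c) * ((u, c) \<bullet> p)"
        using c by (cases p) (simp add: u'_def inner_add_right field_simps)
      moreover have "b' = (- 1 / c) * b" by (simp add: b'_def)
      moreover have "- 1 / c > 0" using c by simp
      ultimately show "(u, c) \<bullet> p = b \<longleftrightarrow> (u', - 1) \<bullet> p = b'" "(u, c) \<bullet> p \<le> b \<longleftrightarrow> (u', - 1) \<bullet> p \<le> b'"
        using mult_cancel_left[of "- 1 / c"] mult_le_cancel_left_pos[of "- 1 / c"] by auto
    qed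
    have le': "u' \<bullet> a - h a \<le> b'" if "a \<in> A" for a
    proof -
      have "(a, h a) \<in> convex hull B" using that by (intro hull_inc) (simp add: B_def)
      with le show ?thesis unfolding scale by auto
    qed
    then have "C = convex hull {a \<in> A. u' \<bullet> a - h a = b'}"
      unfolding C scale by (rule cell)
    moreover from this have "{a \<in> A. u' \<bullet> a - h a = b'} \<noteq> {}" using ne by auto
    ultimately show "C \<in> ?R" using le' by blast
  next
    fix C assume "C \<in> ?R"
    then obtain u b where C: "C = convex hull {a \<in> A. u \<bullet> a - h a = b}"
      and le: "\<And>a. a \<in> A \<Longrightarrow> u \<bullet> a - h a \<le> b" and ne: "\<exists>a\<in>A. u \<bullet> a - h a = b" by blast
    define F where "F = convex hull B \<inter> {p. (u, - 1) \<bullet> p = b}"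
    have "C = fst ` F" unfolding F_def C using cell[of u b, OF le] by simp
    moreover have "F \<noteq> {}" using ne hull_subset[of B convex] by (force simp: F_def B_def)
    moreover have "convex hull B \<subseteq> {p. (u, - 1) \<bullet> p \<le> b}"
      using le by (intro hull_minimal convex_halfspace_le) (auto simp: B_def)
    ultimately have "lower_face F (convex hull B)"
      unfolding lower_face_def
      by (intro conjI exI[of _ u] exI[of _ "- 1 :: real"] exI[of _ b]) (auto simp: F_def)
    then show "C \<in> induced_subdivision A h"
      unfolding induced_subdivision_def lifted_polytope_def B_def[symmetric] using \<open>C = fst ` F\<close> by blast
  qed
qed

text \<open>The offset of the supporting functions absorbs the constant. This allows the height at
  the origin to be normalised to \<open>0\<close>, the diagonal value of a star.\<close>

lemma induced_subdivision_shift: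
  fixes A :: "'a::euclidean_space set"
  assumes "finite A"
  shows "induced_subdivision A (\<lambda>a. h a - d) = induced_subdivision A h"
proof -
  have sub: "induced_subdivision A (\<lambda>a. h a - d) \<subseteq> induced_subdivision A h" for h d
  proof
    fix C assume "C \<in> induced_subdivision A (\<lambda>a. h a - d)"
    then obtain u b where C: "C = convex hull {a \<in> A. u \<bullet> a - (h a - d) = b}"
      "\<forall>a\<in>A. u \<bullet> a - (h a - d) \<le> b" "\<exists>a\<in>A. u \<bullet> a - (h a - d) = b"
      unfolding induced_subdivision_eq[OF assms] by blast
    have "u \<bullet> a - (h a - d) = b \<longleftrightarrow> u \<bullet> a - h a = b - d"
      "u \<bullet> a - (h a - d) \<le> b \<longleftrightarrow> u \<bullet> a - h a \<le> b - d" for a by auto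
    with C show "C \<in> induced_subdivision A h"
      unfolding induced_subdivision_eq[OF assms] by auto
  qed
  show ?thesis using sub[of h d] sub[of "\<lambda>a. h a - d" "- d"] by simp
qed

lemma induced_subdivision_roots:
  fixes c :: "'n::finite \<Rightarrow> 'n \<Rightarrow> ereal"
  assumes h: "\<And>i j. c i j \<noteq> \<infinity> \<Longrightarrow> c i j = ereal (h (root_vec i j))"
  shows "induced_subdivision (roots {(j, i). c i j \<noteq> \<infinity>}) h = star_subdivision c"
proof -
  define A where "A = roots {(j, i). c i j \<noteq> \<infinity>}"
  have fin: "finite A" by (simp add: A_def roots_def)
  have feas: "(\<forall>a\<in>A. u \<bullet> a - h a \<le> b) \<longleftrightarrow> feasible c u (\<chi> j. u $ j + b)" for u b
  proof -
    have "(c i j \<noteq> \<infinity> \<longrightarrow> u $ i - u $ j - h (root_vec i j) \<le> b) \<longleftrightarrow>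
        ereal (u $ i - (u $ j + b)) \<le> c i j" for i j
      using h[of i j] by (cases "c i j = \<infinity>") (auto simp: algebra_simps)
    then show ?thesis by (auto simp: A_def roots_def feasible_def)
  qed
  have tight: "{a \<in> A. u \<bullet> a - h a = b} = roots (tight c u (\<chi> j. u $ j + b))" for u b
  proof -
    have "(c i j \<noteq> \<infinity> \<and> u $ i - u $ j - h (root_vec i j) = b) \<longleftrightarrow>
        c i j = ereal (u $ i - (u $ j + b))" for i j
      using h[of i j] by (cases "c i j = \<infinity>") (auto simp: algebra_simps)
    then have "tight c u (\<chi> j. u $ j + b) = {(j, i). c i j \<noteq> \<infinity> \<and> u $ i - u $ j - h (root_vec i j) = b}"
      by (simp add: tight_def)
    then show ?thesis by (auto simp: A_def roots_def)
  qed
  have ne: "(\<exists>a\<in>A. u \<bullet> a - h a = b) \<longleftrightarrow> tight c u (\<chi> j. u $ j + b) \<noteq> {}" for u b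
  proof -
    have "(\<exists>a\<in>A. u \<bullet> a - h a = b) \<longleftrightarrow> {a \<in> A. u \<bullet> a - h a = b} \<noteq> {}" by blast
    then show ?thesis unfolding tight by (simp add: roots_def)
  qed
  have "induced_subdivision A h = {convex hull (roots (tight c u (\<chi> j. u $ j + b))) | u b.
      feasible c u (\<chi> j. u $ j + b) \<and> tight c u (\<chi> j. u $ j + b) \<noteq> {}}"
    unfolding induced_subdivision_eq[OF fin] feas ne tight ..
  also have "\<dots> = star_subdivision c"
  proof (intro equalityI subsetI)
    fix C assume "C \<in> star_subdivision c"
    then obtain u l b where C: "C = convex hull (roots (tight c u l))" and b: "\<forall>j. l $ j = u $ j + b"
      and l: "feasible c u l" "tight c u l \<noteq> {}"
      by (auto simp: star_subdivision_def)
    have "l = (\<chi> j. u $ j + b)" using b by (simp add: vec_eq_iff)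
    with C l show "C \<in> {convex hull (roots (tight c u (\<chi> j. u $ j + b))) | u b.
      feasible c u (\<chi> j. u $ j + b) \<and> tight c u (\<chi> j. u $ j + b) \<noteq> {}}" by blast
  next
    fix C assume "C \<in> {convex hull (roots (tight c u (\<chi> j. u $ j + b))) | u b.
      feasible c u (\<chi> j. u $ j + b) \<and> tight c u (\<chi> j. u $ j + b) \<noteq> {}}"
    then obtain u b where C: "C = convex hull (roots (tight c u (\<chi> j. u $ j + b)))"
      and l: "feasible c u (\<chi> j. u $ j + b)" "tight c u (\<chi> j. u $ j + b) \<noteq> {}" by blast
    have "\<forall>j. (\<chi> j. u $ j + b) $ j = u $ j + b" by simp
    with C l show "C \<in> star_subdivision c" unfolding star_subdivision_def by blast
  qed
  finally show ?thesis by (simp add: A_def)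
qed

text \<open>Subtracting the same \<open>w\<close> from \<open>u\<close> and \<open>l\<close> keeps
  \<open>l - u\<close> constant, so the cells come from those faces that are cut out by a functional
  with \<open>m - y\<close> constant. Conversely, a move of length \<open>e\<close> scales the
  constant to \<open>e * b\<close>.\<close>

lemma star_subdivision_faces:
  assumes c: "kleene_star c"
  shows "star_subdivision c = {convex hull (roots F) | F. F \<noteq> {} \<and>
    (\<exists>E\<in>alcove_types c. \<exists>y m b. (\<forall>j. m $ j = y $ j + b) \<and> face_by y m E F)}" (is "_ = ?R")
proof (intro equalityI subsetI)
  fix C assume "C \<in> star_subdivision c"
  then obtain u l b where C: "C = convex hull (roots (tight c u l))" and b: "\<And>j. l $ j = u $ j + b"
    and f: "feasible c u l" and ne: "tight c u l \<noteq> {}"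
    by (auto simp: star_subdivision_def)
  obtain w where w: "w \<in> alcove c" "face_by (u - w) (l - w) (tight c w w) (tight c u l)"
    using c f by (rule feasible_face)
  have "tight c w w \<in> alcove_types c" using w(1) by (simp add: alcove_types_def)
  moreover have "\<forall>j. (l - w) $ j = (u - w) $ j + b" using b by simp
  ultimately show "C \<in> ?R" using C ne w(2) by blast
next
  fix C assume "C \<in> ?R"
  then obtain F E y m b where C: "C = convex hull (roots F)" and ne: "F \<noteq> {}"
    and E: "E \<in> alcove_types c" and b: "\<forall>j. m $ j = y $ j + b" and "face_by y m E F"
    by blast
  moreover obtain w where w: "w \<in> alcove c" and "E = tight c w w" using E by (auto simp: alcove_types_def)
  ultimately have f: "face_by y m (tight c w w) F" by simp
  obtain e where e: "feasible c (w + e *\<^sub>R y) (w + e *\<^sub>R m)" "tight c (w + e *\<^sub>R y) (w + e *\<^sub>R m) = F"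
    using w f by (rule face_feasible)
  have "\<forall>j. (w + e *\<^sub>R m) $ j = (w + e *\<^sub>R y) $ j + e * b" using b by (simp add: algebra_simps)
  then show "C \<in> star_subdivision c" using C ne e unfolding star_subdivision_def by blast
qed

section \<open>Cells through the origin and centrality\<close>

lemma face_by_self: "face_by 0 0 E E"
  by (auto simp: face_by_def)

lemma alcove_type_cell:
  assumes c: "kleene_star c" and E: "E \<in> alcove_types c"
  shows "convex hull (roots E) \<in> star_subdivision c" "Id \<subseteq> E"
proof -
  show "Id \<subseteq> E" using E Id_subset_tight[OF c] by (auto simp: alcove_types_def)
  then have "E \<noteq> {}" by auto
  moreover have "\<forall>j. (0::real^'a) $ j = 0 $ j + 0" by simp
  ultimately show "convex hull (roots E) \<in> star_subdivision c"
    unfolding star_subdivision_faces[OF c] using E face_by_self by blast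
qed

text \<open>The roots of \<open>F\<close> lie on the hyperplane \<open>y \<bullet> x = b\<close>. If
  the cell contains \<open>0\<close>, then \<open>b = 0\<close>, hence \<open>m = y\<close>, and the
  perturbed pair is a point of the alcove with graph \<open>F\<close>.\<close>

lemma alcove_types_eq_edges:
  assumes c: "kleene_star c"
  shows "alcove_types c = edges ` {C \<in> star_subdivision c. 0 \<in> C}"
proof (intro equalityI subsetI)
  fix E assume "E \<in> alcove_types c"
  note E = alcove_type_cell[OF c this]
  show "E \<in> edges ` {C \<in> star_subdivision c. 0 \<in> C}"
    using E(1) edges_hull[OF E(2)] zero_in_hull[OF E(2)]
    by (intro image_eqI[of _ _ "convex hull (roots E)"]) auto
next
  fix E assume "E \<in> edges ` {C \<in> star_subdivision c. 0 \<in> C}"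
  then obtain F E' y m b where E: "E = edges (convex hull (roots F))" and zero: "0 \<in> convex hull (roots F)"
    and E': "E' \<in> alcove_types c" and b: "\<forall>j. m $ j = y $ j + b" and "face_by y m E' F"
    unfolding star_subdivision_faces[OF c] by blast
  moreover obtain w where w: "w \<in> alcove c" and "E' = tight c w w" using E' by (auto simp: alcove_types_def)
  ultimately have f: "face_by y m (tight c w w) F" by simp
  have "convex hull (roots F) \<subseteq> {x. y \<bullet> x = b}"
  proof (rule hull_minimal)
    show "roots F \<subseteq> {x. y \<bullet> x = b}" using f b by (auto simp: roots_def face_by_def)
  qed (rule convex_hyperplane)
  with zero have "b = 0" by auto
  with b have "m = y" by (simp add: vec_eq_iff)
  obtain e where e: "feasible c (w + e *\<^sub>R y) (w + e *\<^sub>R m)" "tight c (w + e *\<^sub>R y) (w + e *\<^sub>R m) = F"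
    using w f by (rule face_feasible)
  have "F \<in> alcove_types c"
    using e unfolding \<open>m = y\<close> alcove_types_def alcove_def by blast
  then show "E \<in> alcove_types c" using alcove_type_cell(2)[OF c] edges_hull E by metis
qed

text \<open>A maximal cell belongs to the graph of some \<open>x\<close> in the alcove. At an
  interior point \<open>w\<close> every inequality between distinct nodes is slack, so
  \<open>w - x\<close> is negative on all nonzero roots of the graph and exposes \<open>0\<close> as
  a vertex.\<close>

lemma central_star_subdivision:
  assumes c: "strict_star c"
  shows "central (star_subdivision c)"
  unfolding central_def
proof (intro ballI impI)
  note k = strict_star_kleene[OF c]
  fix C assume C: "C \<in> star_subdivision c" and max: "\<forall>D\<in>star_subdivision c. C \<subseteq> D \<longrightarrow> D = C"
  obtain F E y m where F: "C = convex hull (roots F)" "E \<in> alcove_types c" "face_by y m E F"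
    using C unfolding star_subdivision_faces[OF k] by blast
  have "F \<subseteq> E" using F(3) by (auto simp: face_by_def)
  then have "C \<subseteq> convex hull (roots E)" unfolding F(1) roots_def by (intro hull_mono image_mono)
  then have CE: "C = convex hull (roots E)" using max alcove_type_cell(1)[OF k F(2)] by metis
  obtain x where x: "x \<in> alcove c" "E = tight c x x" using F(2) by (auto simp: alcove_types_def)
  obtain w where "w \<in> alcove c" and w: "\<And>i j. i \<noteq> j \<Longrightarrow> ereal (w $ i - w $ j) < c i j"
    using strict_star_interior[OF c] by blast
  have less: "w $ i - w $ j < x $ i - x $ j" if "(j, i) \<in> E" "i \<noteq> j" for i j
    using that w[of i j] by (simp add: x(2) tight_def)
  have le: "(w - x) \<bullet> p \<le> 0" if "p \<in> roots E" for p
  proof -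
    obtain j i where p: "(j, i) \<in> E" "p = root_vec i j" using \<open>p \<in> roots E\<close> by (auto simp: roots_def)
    then show ?thesis using less[of j i] by (cases "i = j") auto
  qed
  have "roots E \<inter> {p. (w - x) \<bullet> p = 0} = {0}"
  proof -
    have "0 \<in> roots E" using alcove_type_cell(2)[OF k F(2)] by (force simp: roots_def)
    moreover have "p = 0" if "p \<in> roots E" "(w - x) \<bullet> p = 0" for p
    proof -
      obtain j i where p: "(j, i) \<in> E" "p = root_vec i j" using \<open>p \<in> roots E\<close> by (auto simp: roots_def)
      then show ?thesis using less[of j i] that(2) by (cases "i = j") auto
    qed
    ultimately show ?thesis by auto
  qed
  moreover have "finite (roots E)" by (simp add: roots_def)
  ultimately have "{0} face_of (convex hull (roots E))"
    using convex_hull_Int_supporting_hyperplane[of "roots E" "w - x" 0] le by simp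
  then show "0 extreme_point_of C" by (simp add: CE face_of_singleton)
qed

section \<open>Regular central subdivisions as strict stars\<close>

lemma fundamental_config_eq_roots:
  assumes "Id \<subseteq> H" "H - Id = G - Id"
  shows "fundamental_config G = roots H"
proof -
  have "fundamental_config G = insert 0 (roots G)"
    by (auto simp: fundamental_config_def roots_def root_vec_def)
  also have "\<dots> = insert 0 (roots (G - Id))" by (force simp: roots_def)
  also have "\<dots> = insert 0 (roots (H - Id))" by (simp add: assms(2))
  also have "\<dots> = roots H" using assms(1) by (force simp: roots_def)
  finally show ?thesis .
qed

lemma star_subdivision_regular_central:
  fixes c :: "'n::finite \<Rightarrow> 'n \<Rightarrow> ereal"
  assumes c: "strict_star c"
  shows "star_subdivision c \<in> regular_central_subdivisions"
proof -
  note k = strict_star_kleene[OF c]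
  define G where "G = {(j, i). c i j \<noteq> \<infinity>}"
  have "trans G"
  proof (rule transI)
    fix j k' i assume "(j, k') \<in> G" "(k', i) \<in> G"
    then obtain a b where "c i k' = ereal a" "c k' j = ereal b"
      using kleene_star_not_minf[OF k] unfolding G_def by (metis (mono_tags) case_prodD ereal_cases mem_Collect_eq)
    then have "c i j \<le> ereal (a + b)" using kleene_star_triangle[OF k, of i k' a j b] by simp
    then show "(j, i) \<in> G" by (auto simp: G_def)
  qed
  have "Id \<subseteq> G" using kleene_star_refl[OF k] by (auto simp: G_def)
  then have config: "fundamental_config G = roots G" by (rule fundamental_config_eq_roots) simp
  \<comment> \<open>Well defined at finite entries: off the diagonal distinct pairs of nodes give
    distinct roots, and the loops, which all give the origin, share the height
    \<open>0\<close>.\<close>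
  define h where "h a = (THE r. \<exists>i j. a = root_vec i j \<and> c i j = ereal r)" for a
  have "c i j = ereal (h (root_vec i j))" if fin: "c i j \<noteq> \<infinity>" for i j
  proof -
    obtain r where r: "c i j = ereal r" using fin kleene_star_not_minf[OF k, of i j] by (cases "c i j") auto
    have "h (root_vec i j) = r"
      unfolding h_def
    proof (rule the_equality)
      show "s = r" if "\<exists>i' j'. root_vec i j = root_vec i' j' \<and> c i' j' = ereal s" for s
        using that r kleene_star_refl[OF k] unfolding root_vec_eq_iff by auto
    qed (use r in blast)
    with r show ?thesis by simp
  qed
  then have "induced_subdivision (fundamental_config G) h = star_subdivision c"
    unfolding config unfolding G_def by (rule induced_subdivision_roots)
  then have "regular_subdivision (fundamental_config G) (star_subdivision c)"
    unfolding regular_subdivision_def by metis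
  then show ?thesis
    unfolding regular_central_subdivisions_def using \<open>trans G\<close> central_star_subdivision[OF c] by blast
qed

text \<open>The chosen root is a vertex of the configuration, so some cell contains it. A maximal
  cell above has \<open>0\<close> as a vertex by centrality; this forces its offset to be
  \<open>0\<close>, and its slope is a point of the alcove.\<close>

lemma central_cell_through_root:
  fixes c :: "'n::finite \<Rightarrow> 'n \<Rightarrow> ereal"
  assumes c: "\<And>i. c i i = 0" "\<And>i j. c i j \<noteq> -\<infinity>" and central: "central (star_subdivision c)"
    and r: "c i0 j0 = ereal r" and "i0 \<noteq> j0"
  obtains u where "u \<in> alcove c" "c i0 j0 = ereal (u $ i0 - u $ j0)"
    "0 extreme_point_of (convex hull (roots (tight c u u)))"
proof -
  define N where "N = \<bar>r\<bar> + (\<Sum>i\<in>UNIV. \<Sum>j\<in>UNIV. \<bar>real_of_ereal (c i j)\<bar>)"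
  have N: "\<bar>r\<bar> + \<bar>real_of_ereal (c i j)\<bar> \<le> N" for i j
  proof -
    have "\<bar>real_of_ereal (c i j)\<bar> \<le> (\<Sum>j\<in>UNIV. \<bar>real_of_ereal (c i j)\<bar>)"
      by (intro member_le_sum abs_ge_zero UNIV_I finite)
    also have "\<dots> \<le> (\<Sum>i\<in>UNIV. \<Sum>j\<in>UNIV. \<bar>real_of_ereal (c i j)\<bar>)"
      by (intro member_le_sum sum_nonneg abs_ge_zero UNIV_I finite)
    finally show ?thesis by (simp add: N_def)
  qed
  \<comment> \<open>On this slope the chosen root has value \<open>2 * N\<close>, all others at most
    \<open>N\<close>. The offset \<open>2 * N - r\<close> makes the chosen edge tight, and the gap
    \<open>N\<close> outweighs \<open>r\<close> together with any finite entry.\<close>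
  define u where "u = N *\<^sub>R root_vec i0 j0"
  define l where "l = (\<chi> j. u $ j + (2 * N - r))"
  have "N \<ge> 0" using N[of i0 j0] by linarith
  have "ereal (u $ i - l $ j) \<le> c i j" for i j
  proof (cases "(i, j) = (i0, j0)")
    case True
    then show ?thesis using r \<open>i0 \<noteq> j0\<close> by (simp add: u_def l_def root_vec_nth)
  next
    case False
    then have "u $ i - u $ j \<le> N" using \<open>N \<ge> 0\<close> \<open>i0 \<noteq> j0\<close> by (auto simp: u_def root_vec_nth)
    then show ?thesis using c(2)[of i j] N[of i j] by (cases "c i j") (auto simp: l_def)
  qed
  then have "feasible c u l" by (simp add: feasible_def)
  moreover have t: "(j0, i0) \<in> tight c u l"
    using r \<open>i0 \<noteq> j0\<close> by (simp add: tight_def u_def l_def root_vec_nth)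
  moreover have "\<forall>j. l $ j = u $ j + (2 * N - r)" by (simp add: l_def)
  ultimately have C: "convex hull (roots (tight c u l)) \<in> star_subdivision c"
    unfolding star_subdivision_def by blast
  have "star_subdivision c \<subseteq> range (\<lambda>F. convex hull (roots F))" by (auto simp: star_subdivision_def)
  then have "finite (star_subdivision c)" by (rule finite_subset) simp
  from finite_has_maximal2[OF this C] obtain D where D: "D \<in> star_subdivision c"
    "convex hull (roots (tight c u l)) \<subseteq> D" "\<And>D'. D' \<in> star_subdivision c \<Longrightarrow> D \<subseteq> D' \<Longrightarrow> D' = D"
    by metis
  have ext: "0 extreme_point_of D" using central D unfolding central_def by blast
  obtain v m b where v: "D = convex hull (roots (tight c v m))" "\<And>j. m $ j = v $ j + b" "feasible c v m"
    using D(1) by (auto simp: star_subdivision_def)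
  \<comment> \<open>An extreme point of the hull is one of the spanning roots, so \<open>0\<close>
    comes from a tight loop, and \<open>c i i = 0\<close> gives \<open>b = 0\<close>.\<close>
  have "0 \<in> roots (tight c v m)" using ext unfolding v(1) by (rule extreme_point_of_convex_hull)
  then obtain i where "(i, i) \<in> tight c v m" by (force simp: roots_def root_vec_eq_0_iff)
  then have "b = 0" using c(1) v(2) by (simp add: tight_def zero_ereal_def)
  then have "m = v" using v(2) by (simp add: vec_eq_iff)
  have "root_vec i0 j0 \<in> roots (tight c u l)" using t by (force simp: roots_def)
  then have "root_vec i0 j0 \<in> D" by (intro subsetD[OF D(2)] hull_inc)
  then have "(j0, i0) \<in> tight c v v" using root_vec_in_hull \<open>i0 \<noteq> j0\<close> v(1) \<open>m = v\<close> by blast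
  then show ?thesis
    using that[of v] v ext \<open>m = v\<close> by (simp add: tight_def alcove_def)
qed

text \<open>A point \<open>u\<close> of the alcove tight at \<open>(j, i)\<close> yields the
  triangle inequality, as \<open>c i j = (u $ i - u $ k) + (u $ k - u $ j)\<close>; transitivity
  makes \<open>c i j\<close> finite, so that \<open>u\<close> exists. If
  \<open>c i j + c j i \<le> 0\<close>, both opposite edges are tight at \<open>u\<close>, and
  \<open>0\<close> is the midpoint of their roots, hence no vertex.\<close>

lemma central_imp_strict_star:
  fixes c :: "'n::finite \<Rightarrow> 'n \<Rightarrow> ereal"
  assumes c: "\<And>i. c i i = 0" "\<And>i j. c i j \<noteq> -\<infinity>" and central: "central (star_subdivision c)"
    and trans: "\<And>i j k. i \<noteq> j \<Longrightarrow> c i k \<noteq> \<infinity> \<Longrightarrow> c k j \<noteq> \<infinity> \<Longrightarrow> c i j \<noteq> \<infinity>"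
  shows "strict_star c"
proof -
  note cell = central_cell_through_root[of c, OF c central]
  have fin: "\<exists>r. c i j = ereal r" if "c i j \<noteq> \<infinity>" for i j
    using that c(2)[of i j] by (cases "c i j") auto
  have strict: "0 < c i j + c j i" if ij: "i \<noteq> j" for i j
  proof (rule ccontr)
    assume not: "\<not> 0 < c i j + c j i"
    then obtain a b where ab: "c i j = ereal a" "c j i = ereal b" "a + b \<le> 0"
      using c(2)[of i j] c(2)[of j i] by (cases "c i j"; cases "c j i") (auto simp: zero_ereal_def)
    obtain u where u: "u \<in> alcove c" "c i j = ereal (u $ i - u $ j)"
      "0 extreme_point_of (convex hull (roots (tight c u u)))"
      using cell[OF ab(1) ij] by blast
    have "u $ j - u $ i \<le> b" using alcoveD[OF u(1), of j i] ab(2) by simp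
    then have "c j i = ereal (u $ j - u $ i)" using u(2) ab by simp
    then have "(j, i) \<in> tight c u u" "(i, j) \<in> tight c u u" using u(2) by (auto simp: tight_def)
    then have "root_vec i j \<in> roots (tight c u u)" "root_vec j i \<in> roots (tight c u u)"
      by (force simp: roots_def)+
    then have "0 \<notin> open_segment (root_vec i j) (root_vec j i)"
      using u(3) hull_inc unfolding extreme_point_of_def by metis
    moreover have "midpoint (root_vec i j) (root_vec j i) = 0"
      unfolding midpoint_def using root_vec_uminus[of i j] by (metis add.right_inverse scaleR_zero_right)
    moreover have "root_vec i j \<noteq> root_vec j i" using ij by (simp add: root_vec_eq_iff)
    ultimately show False using midpoint_in_open_segment by metis
  qed
  have "c i j \<le> c i k + c k j" for i j k
  proof (cases "i = j")
    case True
    then show ?thesis using strict[of i k] c(1) by (cases "i = k") (auto simp: less_imp_le)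
  next
    case False
    show ?thesis
    proof (cases "c i k = \<infinity> \<or> c k j = \<infinity>")
      case True
      then show ?thesis by auto
    next
      case fin': False
      then obtain a b r where r: "c i k = ereal a" "c k j = ereal b" "c i j = ereal r"
        using fin trans[OF False] by metis
      obtain u where u: "u \<in> alcove c" "c i j = ereal (u $ i - u $ j)"
        using cell[OF r(3) False] by blast
      show ?thesis using alcoveD[OF u(1), of i k] alcoveD[OF u(1), of k j] u(2) r by simp
    qed
  qed
  then show ?thesis using c strict by (simp add: strict_star_def kleene_star_def)
qed

lemma regular_central_subdivisions_eq:
  "regular_central_subdivisions = star_subdivision ` {c :: 'n::finite \<Rightarrow> 'n \<Rightarrow> ereal. strict_star c}"
proof (intro equalityI subsetI)
  fix S :: "(real^'n) set set" assume "S \<in> regular_central_subdivisions"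
  then obtain G h where G: "trans G" and S: "S = induced_subdivision (fundamental_config G) h" "central S"
    by (auto simp: regular_central_subdivisions_def regular_subdivision_def)
  \<comment> \<open>Heights relative to that of the origin; the diagonal is \<open>0\<close> whether
    or not \<open>G\<close> has the loop, and missing edges get \<open>\<infinity>\<close>.\<close>
  define c where "c i j = (if i = j then 0 else if (j, i) \<in> G then ereal (h (root_vec i j) - h 0) else \<infinity>)" for i j
  have config: "fundamental_config G = roots {(j, i). c i j \<noteq> \<infinity>}"
    by (rule fundamental_config_eq_roots) (auto simp: c_def split: if_splits)
  have fin: "finite (fundamental_config G)" by (simp add: config roots_def)
  have "S = induced_subdivision (fundamental_config G) (\<lambda>a. h a - h 0)"
    unfolding S(1) induced_subdivision_shift[OF fin] ..
  also have "\<dots> = star_subdivision c"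
    unfolding config by (rule induced_subdivision_roots) (auto simp: c_def zero_ereal_def split: if_splits)
  finally have Sc: "S = star_subdivision c" .
  have "strict_star c"
  proof (rule central_imp_strict_star)
    show "c i j \<noteq> \<infinity>" if "i \<noteq> j" "c i k \<noteq> \<infinity>" "c k j \<noteq> \<infinity>" for i j k
      using that transD[OF G, of j k i] by (auto simp: c_def split: if_splits)
  qed (use S(2) Sc in \<open>auto simp: c_def\<close>)
  then show "S \<in> star_subdivision ` {c. strict_star c}" using Sc by blast
next
  fix S :: "(real^'n) set set" assume "S \<in> star_subdivision ` {c. strict_star c}"
  then show "S \<in> regular_central_subdivisions" using star_subdivision_regular_central by blast
qed

section \<open>Combinatorial types\<close>

text \<open>A tight entry in every column says that each \<open>l $ j\<close> is as small as
  feasibility allows, namely the residuum of \<open>x\<close> against column \<open>j\<close>; so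
  \<open>x\<close> determines the pair.\<close>

definition cov_types :: "('n::finite \<Rightarrow> 'n \<Rightarrow> ereal) \<Rightarrow> ('n \<times> 'n) set set" where
  "cov_types c = {tight c x l | x l. feasible c x l \<and> fst ` tight c x l = UNIV}"

definition same_type :: "('n::finite \<Rightarrow> 'n \<Rightarrow> ereal) \<Rightarrow> ('n \<Rightarrow> 'n \<Rightarrow> ereal) \<Rightarrow> bool" where
  "same_type c c' \<longleftrightarrow> (\<exists>\<sigma>. bij \<sigma> \<and> alcove_types c' = image (map_prod \<sigma> \<sigma>) ` alcove_types c)"

lemma cov_types_eq_hits:
  assumes c: "kleene_star c"
  shows "cov_types c = range (\<lambda>p. {(j, i). hits (column c j) i p})"
proof -
  have hits_eq: "{(j, i). hits (column c j) i x} = tight c x l"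
    if f: "feasible c x l" and cover: "\<And>j. \<exists>i. c i j = ereal (x $ i - l $ j)" for x l
  proof -
    have "hits (column c j) i x \<longleftrightarrow> c i j = ereal (x $ i - l $ j)" for i j
    proof
      assume "hits (column c j) i x"
      then obtain r where r: "c i j = ereal r" "\<And>k. ereal (x $ k - x $ i + r) \<le> c k j"
        by (auto simp: hits_def)
      obtain k where "c k j = ereal (x $ k - l $ j)" using cover by blast
      then have "r \<le> x $ i - l $ j" using r(2)[of k] by simp
      moreover have "ereal (x $ i - l $ j) \<le> c i j" using f by (simp add: feasible_def)
      ultimately show "c i j = ereal (x $ i - l $ j)" using r(1) by simp
    next
      assume eq: "c i j = ereal (x $ i - l $ j)"
      have "ereal (x $ k - x $ i + (x $ i - l $ j)) \<le> c k j" for k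
        using f by (simp add: feasible_def)
      with eq show "hits (column c j) i x" by (auto simp: hits_def)
    qed
    then show ?thesis by (simp add: tight_def)
  qed
  show ?thesis
  proof (intro equalityI subsetI)
    fix F assume "F \<in> cov_types c"
    then obtain x l where F: "F = tight c x l" "feasible c x l" "fst ` tight c x l = UNIV"
      by (auto simp: cov_types_def)
    have "\<exists>i. c i j = ereal (x $ i - l $ j)" for j
    proof -
      have "j \<in> fst ` tight c x l" using F(3) by simp
      then show ?thesis by (auto simp: tight_def)
    qed
    then show "F \<in> range (\<lambda>p. {(j, i). hits (column c j) i p})" using hits_eq F by blast
  next
    fix F assume "F \<in> range (\<lambda>p. {(j, i). hits (column c j) i p})"
    then obtain p where F: "F = {(j, i). hits (column c j) i p}" by blast
    have "\<exists>i. hits (column c j) i p" for j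
      using kleene_star_not_minf[OF c] kleene_star_refl[OF c, of j]
      by (intro hits_exists[of _ j]) auto
    then have "\<exists>t. \<exists>i. c i j = ereal (p $ i - t) \<and> (\<forall>k. ereal (p $ k - t) \<le> c k j)" for j
    proof -
      obtain i r where "c i j = ereal r" "\<forall>k. ereal (p $ k - p $ i + r) \<le> c k j"
        using \<open>\<exists>i. hits (column c j) i p\<close> by (auto simp: hits_def)
      then show ?thesis by (intro exI[of _ "p $ i - r"] exI[of _ i]) (auto simp: algebra_simps)
    qed
    then obtain t where t: "\<And>j. \<exists>i. c i j = ereal (p $ i - t j) \<and> (\<forall>k. ereal (p $ k - t j) \<le> c k j)"
      by metis
    define l where "l = (\<chi> j. t j)"
    have f: "feasible c p l" using t by (auto simp: feasible_def l_def)
    have cover: "\<exists>i. c i j = ereal (p $ i - l $ j)" for j using t[of j] by (auto simp: l_def)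
    have "fst ` tight c p l = UNIV"
    proof -
      have "j \<in> fst ` tight c p l" for j using cover[of j] by (force simp: tight_def)
      then show ?thesis by blast
    qed
    then show "F \<in> cov_types c" using hits_eq[OF f cover] f F unfolding cov_types_def by blast
  qed
qed

lemma TC_generated:
  assumes V: "trop_config V" and c: "kleene_star c" and g: "generated_by V c \<pi>"
  shows "image (map_prod \<pi> id) ` TC V = cov_types c"
proof -
  have bij: "bij_betw \<pi> {..<length V} UNIV" using g by (simp add: generated_by_def)
  have hits: "hits (V ! k) i p \<longleftrightarrow> hits (column c (\<pi> k)) i p" if "k < length V" for k i p
  proof -
    obtain t where "\<And>i. V ! k $ i = column c (\<pi> k) $ i + ereal t"
      using g \<open>k < length V\<close> by (auto simp: generated_by_def)
    then show ?thesis by (rule hits_shift_iff)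
  qed
  have "map_prod \<pi> id ` covector V p = {(j, i). hits (column c j) i p}" for p
  proof (intro equalityI subsetI)
    fix e assume "e \<in> {(j, i). hits (column c j) i p}"
    then obtain j i where e: "e = (j, i)" "hits (column c j) i p" by blast
    obtain k where k: "k < length V" "\<pi> k = j" using bij by (metis UNIV_I bij_betw_iff_bijections lessThan_iff)
    then show "e \<in> map_prod \<pi> id ` covector V p"
      using e hits[OF k(1)] unfolding covector_eq[OF V] by (intro image_eqI[of _ _ "(k, i)"]) auto
  qed (auto simp: covector_eq[OF V] hits)
  then show ?thesis unfolding cov_types_eq_hits[OF c] TC_def image_image by simp
qed

lemma TC_subset: "F \<in> TC V \<Longrightarrow> F \<subseteq> {..<length V} \<times> UNIV"
  by (auto simp: TC_def covector_def)

lemma cov_types_faces: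
  assumes c: "kleene_star c"
  shows "cov_types c = {F. fst ` F = UNIV \<and> (\<exists>E\<in>alcove_types c. \<exists>y m. face_by y m E F)}"
proof (intro equalityI subsetI)
  fix F assume "F \<in> cov_types c"
  then obtain x l where F: "F = tight c x l" "feasible c x l" "fst ` tight c x l = UNIV"
    by (auto simp: cov_types_def)
  obtain w where w: "w \<in> alcove c" "face_by (x - w) (l - w) (tight c w w) (tight c x l)"
    using c F(2) by (rule feasible_face)
  have "tight c w w \<in> alcove_types c" using w(1) by (simp add: alcove_types_def)
  then show "F \<in> {F. fst ` F = UNIV \<and> (\<exists>E\<in>alcove_types c. \<exists>y m. face_by y m E F)}"
    using F w(2) by blast
next
  fix F assume "F \<in> {F. fst ` F = UNIV \<and> (\<exists>E\<in>alcove_types c. \<exists>y m. face_by y m E F)}"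
  then obtain E y m where F: "fst ` F = UNIV" and E: "E \<in> alcove_types c" and f: "face_by y m E F" by blast
  obtain w where w: "w \<in> alcove c" "E = tight c w w" using E by (auto simp: alcove_types_def)
  obtain e where "feasible c (w + e *\<^sub>R y) (w + e *\<^sub>R m)" "tight c (w + e *\<^sub>R y) (w + e *\<^sub>R m) = F"
    using w(1) f[unfolded w(2)] by (rule face_feasible)
  then show "F \<in> cov_types c" using F unfolding cov_types_def by blast
qed

text \<open>If coordinate \<open>i\<close> is tight in column \<open>j\<close>, then
  \<open>x $ k - l $ j \<le> c k j \<le> c k i + x $ i - l $ j\<close>, so \<open>x\<close> lies in
  the alcove. A tight entry of column \<open>i\<close> then gives \<open>l $ i \<le> x $ i\<close>,
  and the diagonal gives the reverse.\<close>

lemma alcove_types_eq_cov_types: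
  assumes c: "kleene_star c"
  shows "alcove_types c = {F \<in> cov_types c. snd ` F = UNIV}"
proof (intro equalityI subsetI)
  fix F assume "F \<in> alcove_types c"
  then obtain x where x: "feasible c x x" "F = tight c x x" by (auto simp: alcove_types_def alcove_def)
  have Id: "(i, i) \<in> tight c x x" for i using Id_subset_tight[OF c] by blast
  have "i \<in> fst ` tight c x x" "i \<in> snd ` tight c x x" for i using Id[of i] by force+
  then have "fst ` tight c x x = UNIV" "snd ` tight c x x = UNIV" by blast+
  then show "F \<in> {F \<in> cov_types c. snd ` F = UNIV}" using x unfolding cov_types_def by blast
next
  fix F assume "F \<in> {F \<in> cov_types c. snd ` F = UNIV}"
  then obtain x l where F: "F = tight c x l" "feasible c x l" and
    cover: "fst ` tight c x l = UNIV" "snd ` tight c x l = UNIV"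
    by (auto simp: cov_types_def)
  have le: "ereal (x $ k - x $ i) \<le> c k i" for k i
  proof (cases "c k i")
    case (real s)
    have "i \<in> snd ` tight c x l" using cover(2) by simp
    then obtain j where j: "c i j = ereal (x $ i - l $ j)" by (auto simp: tight_def)
    have "c k j \<le> ereal (s + (x $ i - l $ j))"
      by (rule kleene_star_triangle[OF c, of k i]) (use real j in auto)
    moreover have "ereal (x $ k - l $ j) \<le> c k j" using F(2) by (simp add: feasible_def)
    ultimately have "ereal (x $ k - l $ j) \<le> ereal (s + (x $ i - l $ j))" by (rule order_trans[rotated])
    then show ?thesis using real by simp
  qed (use kleene_star_not_minf[OF c, of k i] in auto)
  have "l $ i = x $ i" for i
  proof -
    have "i \<in> fst ` tight c x l" using cover(1) by simp
    then obtain k where "c k i = ereal (x $ k - l $ i)" by (auto simp: tight_def)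
    then have "l $ i \<le> x $ i" using le[of k i] by simp
    moreover have "ereal (x $ i - l $ i) \<le> c i i" using F(2) unfolding feasible_def by blast
    then have "x $ i \<le> l $ i" by (simp add: kleene_star_refl[OF c] zero_ereal_def)
    ultimately show ?thesis by simp
  qed
  then have "l = x" by (simp add: vec_eq_iff)
  then show "F \<in> alcove_types c" using F by (auto simp: alcove_types_def alcove_def)
qed

lemma Id_in_alcove_types:
  assumes c: "strict_star c"
  shows "Id \<in> alcove_types c"
proof -
  obtain w where w: "w \<in> alcove c" "\<And>i j. i \<noteq> j \<Longrightarrow> ereal (w $ i - w $ j) < c i j"
    using strict_star_interior[OF c] by blast
  have "tight c w w = Id"
  proof
    show "tight c w w \<subseteq> Id"
    proof (rule subrelI)
      fix j i assume "(j, i) \<in> tight c w w"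
      then show "(j, i) \<in> Id" using w(2)[of i j] by (cases "i = j") (auto simp: tight_def)
    qed
  qed (rule Id_subset_tight[OF strict_star_kleene[OF c]])
  with w(1) show ?thesis by (force simp: alcove_types_def)
qed

section \<open>Relabelling the nodes\<close>

lemma image_eq_of_inverse:
  assumes "f ` A \<subseteq> B" "g ` B \<subseteq> A" "\<And>b. f (g b) = b"
  shows "f ` A = B"
  using assms by (metis image_eqI image_subset_iff subsetI subset_antisym)

lemma relabel_nth [simp]: "bij \<sigma> \<Longrightarrow> relabel \<sigma> x $ \<sigma> i = x $ i"
  by (simp add: relabel_def bij_is_inj)

lemma relabel_root_vec:
  assumes "bij \<sigma>"
  shows "relabel \<sigma> (root_vec i j) = root_vec (\<sigma> i) (\<sigma> j)"
proof -
  have "i = inv \<sigma> k \<longleftrightarrow> \<sigma> i = k" for i k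
    using assms by (metis bij_inv_eq_iff)
  then show ?thesis by (simp add: vec_eq_iff relabel_def root_vec_nth)
qed

lemma linear_relabel: "linear (relabel \<sigma>)"
  by (rule linearI) (simp_all add: relabel_def vec_eq_iff)

lemma relabel_hull_roots:
  assumes "bij \<sigma>"
  shows "relabel \<sigma> ` (convex hull (roots F)) = convex hull (roots (map_prod \<sigma> \<sigma> ` F))"
proof -
  have "relabel \<sigma> ` roots F = roots (map_prod \<sigma> \<sigma> ` F)"
    unfolding roots_def image_image by (rule image_cong) (auto simp: relabel_root_vec[OF assms])
  then show ?thesis by (simp add: convex_hull_linear_image[OF linear_relabel])
qed

lemma relabel_inv:
  assumes "bij \<sigma>"
  shows "relabel \<sigma> (relabel (inv \<sigma>) x) = x"
  using assms by (simp add: relabel_def vec_eq_iff bij_is_inj inv_inv_eq bij_is_surj surj_f_inv_f)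

lemma map_prod_inv:
  assumes "bij \<sigma>"
  shows "map_prod \<sigma> \<sigma> ` map_prod (inv \<sigma>) (inv \<sigma>) ` E = E"
  using assms by (force simp: image_image bij_is_surj surj_f_inv_f)

lemma inv_map_prod:
  assumes "bij \<sigma>"
  shows "map_prod (inv \<sigma>) (inv \<sigma>) ` map_prod \<sigma> \<sigma> ` E = E"
  using map_prod_inv[OF bij_imp_bij_inv[OF assms], of E] assms by (simp add: inv_inv_eq)

lemma edges_relabel:
  assumes "bij \<sigma>"
  shows "edges (relabel \<sigma> ` C) = map_prod \<sigma> \<sigma> ` edges C"
proof (intro equalityI subsetI)
  fix e assume "e \<in> edges (relabel \<sigma> ` C)"
  then obtain j i x where e: "e = (j, i)" "root_vec i j = relabel \<sigma> x" "x \<in> C" by (auto simp: edges_def)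
  obtain i' j' where ij: "i = \<sigma> i'" "j = \<sigma> j'" using assms by (metis bij_pointE)
  have "x = root_vec i' j'"
  proof -
    have "relabel \<sigma> x = relabel \<sigma> (root_vec i' j')" using e(2) ij by (simp add: relabel_root_vec[OF assms])
    then show ?thesis using relabel_nth[OF assms] by (metis vec_eq_iff)
  qed
  then show "e \<in> map_prod \<sigma> \<sigma> ` edges C" using e ij by (force simp: edges_def)
next
  fix e assume "e \<in> map_prod \<sigma> \<sigma> ` edges C"
  then show "e \<in> edges (relabel \<sigma> ` C)"
    by (auto simp: edges_def relabel_root_vec[OF assms, symmetric])
qed

lemma face_by_relabel:
  assumes "bij \<sigma>" "face_by y m E F"
  shows "face_by (relabel \<sigma> y) (relabel \<sigma> m) (map_prod \<sigma> \<sigma> ` E) (map_prod \<sigma> \<sigma> ` F)"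
proof -
  have "F = {(j, i) \<in> E. y $ i = m $ j}" and "\<And>i j. (j, i) \<in> E \<Longrightarrow> y $ i \<le> m $ j"
    using assms(2) by (auto simp: face_by_def)
  then show ?thesis using assms(1) by (auto simp: face_by_def)
qed

lemma permutes_UNIV_iff_bij: "\<sigma> permutes UNIV \<longleftrightarrow> bij \<sigma>"
  by (simp add: permutes_def bij_iff)

lemma alcove_types_inv:
  assumes "bij \<sigma>" "alcove_types c' = image (map_prod \<sigma> \<sigma>) ` alcove_types c"
  shows "alcove_types c = image (map_prod (inv \<sigma>) (inv \<sigma>)) ` alcove_types c'"
  unfolding assms(2) image_image inv_map_prod[OF assms(1), unfolded image_image]
  using inv_map_prod[OF assms(1)] by (simp add: image_image)

lemma cov_types_relabel_subset:
  fixes c c' :: "'n::finite \<Rightarrow> 'n \<Rightarrow> ereal"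
  assumes c: "kleene_star c" "kleene_star c'" and \<sigma>: "bij \<sigma>"
    and eq: "alcove_types c' = image (map_prod \<sigma> \<sigma>) ` alcove_types c"
  shows "image (map_prod \<sigma> \<sigma>) ` cov_types c \<subseteq> cov_types c'"
proof (rule image_subsetI)
  fix F assume "F \<in> cov_types c"
  then obtain E y m where F: "fst ` F = UNIV" "E \<in> alcove_types c" "face_by y m E F"
    unfolding cov_types_faces[OF c(1)] by blast
  have "fst ` (map_prod \<sigma> \<sigma> ` F) = \<sigma> ` fst ` F" by (force simp: image_image)
  also have "\<dots> = UNIV" using F(1) \<sigma> by (simp add: bij_is_surj)
  finally have "fst ` (map_prod \<sigma> \<sigma> ` F) = UNIV" .
  moreover have "map_prod \<sigma> \<sigma> ` E \<in> alcove_types c'" using F(2) eq by blast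
  ultimately show "map_prod \<sigma> \<sigma> ` F \<in> cov_types c'"
    unfolding cov_types_faces[OF c(2)] using face_by_relabel[OF \<sigma> F(3)] by blast
qed

lemma cov_types_relabel:
  fixes c c' :: "'n::finite \<Rightarrow> 'n \<Rightarrow> ereal"
  assumes c: "kleene_star c" "kleene_star c'" and \<sigma>: "bij \<sigma>"
    and eq: "alcove_types c' = image (map_prod \<sigma> \<sigma>) ` alcove_types c"
  shows "cov_types c' = image (map_prod \<sigma> \<sigma>) ` cov_types c"
  using image_eq_of_inverse[OF cov_types_relabel_subset[OF c \<sigma> eq]
    cov_types_relabel_subset[OF c(2,1) bij_imp_bij_inv[OF \<sigma>] alcove_types_inv[OF \<sigma> eq]]]
    map_prod_inv[OF \<sigma>] by simp

lemma star_subdivision_relabel_subset: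
  fixes c c' :: "'n::finite \<Rightarrow> 'n \<Rightarrow> ereal"
  assumes c: "kleene_star c" "kleene_star c'" and \<sigma>: "bij \<sigma>"
    and eq: "alcove_types c' = image (map_prod \<sigma> \<sigma>) ` alcove_types c"
  shows "image (relabel \<sigma>) ` star_subdivision c \<subseteq> star_subdivision c'"
proof (rule image_subsetI)
  fix C assume "C \<in> star_subdivision c"
  then obtain F E y m b where F: "C = convex hull (roots F)" "F \<noteq> {}" "E \<in> alcove_types c"
    "\<forall>j. m $ j = y $ j + b" "face_by y m E F"
    unfolding star_subdivision_faces[OF c(1)] by blast
  have "\<forall>j. relabel \<sigma> m $ j = relabel \<sigma> y $ j + b" using F(4) by (simp add: relabel_def)
  moreover have "map_prod \<sigma> \<sigma> ` E \<in> alcove_types c'" using F(3) eq by blast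
  moreover have "map_prod \<sigma> \<sigma> ` F \<noteq> {}" using F(2) by simp
  ultimately show "relabel \<sigma> ` C \<in> star_subdivision c'"
    unfolding star_subdivision_faces[OF c(2)] F(1) relabel_hull_roots[OF \<sigma>]
    using face_by_relabel[OF \<sigma> F(5)] by blast
qed

lemma star_subdivision_relabel:
  fixes c c' :: "'n::finite \<Rightarrow> 'n \<Rightarrow> ereal"
  assumes c: "kleene_star c" "kleene_star c'" and \<sigma>: "bij \<sigma>"
    and eq: "alcove_types c' = image (map_prod \<sigma> \<sigma>) ` alcove_types c"
  shows "star_subdivision c' = image (relabel \<sigma>) ` star_subdivision c"
proof -
  have "relabel \<sigma> ` relabel (inv \<sigma>) ` C = C" for C by (simp add: image_image relabel_inv[OF \<sigma>])
  then show ?thesis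
    using image_eq_of_inverse[OF star_subdivision_relabel_subset[OF c \<sigma> eq]
      star_subdivision_relabel_subset[OF c(2,1) bij_imp_bij_inv[OF \<sigma>] alcove_types_inv[OF \<sigma> eq]]] by simp
qed

text \<open>Relabelling fixes the origin, so it matches the cells through the origin, and the graphs
  are read off from these.\<close>

lemma alcove_types_of_star_subdivision:
  fixes c c' :: "'n::finite \<Rightarrow> 'n \<Rightarrow> ereal"
  assumes c: "kleene_star c" "kleene_star c'" and \<sigma>: "bij \<sigma>"
    and eq: "star_subdivision c' = image (relabel \<sigma>) ` star_subdivision c"
  shows "alcove_types c' = image (map_prod \<sigma> \<sigma>) ` alcove_types c"
proof -
  have "relabel \<sigma> 0 = 0" by (rule linear_0[OF linear_relabel])
  moreover have "x = 0" if "relabel \<sigma> x = 0" for x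
    using that relabel_nth[OF \<sigma>, of x] by (simp add: vec_eq_iff)
  ultimately have "0 \<in> relabel \<sigma> ` C \<longleftrightarrow> 0 \<in> C" for C by (metis image_iff)
  then have "{C \<in> star_subdivision c'. 0 \<in> C} = image (relabel \<sigma>) ` {C \<in> star_subdivision c. 0 \<in> C}"
    unfolding eq by blast
  then show ?thesis
    unfolding alcove_types_eq_edges[OF c(1)] alcove_types_eq_edges[OF c(2)]
    by (simp add: image_image edges_relabel[OF \<sigma>])
qed

section \<open>The two equivalences in terms of stars\<close>

lemma subdivision_equiv_iff:
  assumes c: "strict_star c" "strict_star c'"
  shows "(star_subdivision c, star_subdivision c') \<in> subdivision_equiv \<longleftrightarrow> same_type c c'"
proof -
  note k = c[THEN strict_star_kleene]
  have eq: "star_subdivision c' = image (relabel \<sigma>) ` star_subdivision c \<longleftrightarrow>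
      alcove_types c' = image (map_prod \<sigma> \<sigma>) ` alcove_types c" if "bij \<sigma>" for \<sigma>
    using star_subdivision_relabel[OF k that] alcove_types_of_star_subdivision[OF k that] by blast
  have "(\<exists>\<sigma>. bij \<sigma> \<and> star_subdivision c' = image (relabel \<sigma>) ` star_subdivision c) \<longleftrightarrow>
      same_type c c'"
    unfolding same_type_def by (intro ex_cong1 conj_cong refl eq)
  with c[THEN star_subdivision_regular_central] show ?thesis
    by (simp add: subdivision_equiv_def permutes_UNIV_iff_bij)
qed

text \<open>Covering all coordinates is invariant under \<open>(\<rho>, \<sigma>)\<close>, so the
  equality restricts to \<open>alcove_types\<close>. Every member there contains the diagonal, in
  particular the image of \<open>Id\<close> does, which forces
  \<open>\<rho> = \<sigma>\<close>.\<close>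

lemma same_labelling:
  assumes c: "strict_star c" "strict_star c'" and bij: "bij \<rho>" "bij \<sigma>"
    and eq: "cov_types c' = image (map_prod \<rho> \<sigma>) ` cov_types c"
  shows "\<rho> = \<sigma>" "alcove_types c' = image (map_prod \<sigma> \<sigma>) ` alcove_types c"
proof -
  note k = c[THEN strict_star_kleene]
  have "snd ` map_prod \<rho> \<sigma> ` F = UNIV \<longleftrightarrow> snd ` F = UNIV" for F
  proof -
    have "snd ` map_prod \<rho> \<sigma> ` F = \<sigma> ` snd ` F" by (force simp: image_image)
    then show ?thesis using bij(2) by (metis bij_is_inj bij_is_surj inj_image_eq_iff)
  qed
  then have eq': "alcove_types c' = image (map_prod \<rho> \<sigma>) ` alcove_types c"
    unfolding alcove_types_eq_cov_types[OF k(1)] alcove_types_eq_cov_types[OF k(2)] eq by blast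
  then have "map_prod \<rho> \<sigma> ` Id \<in> alcove_types c'" using Id_in_alcove_types[OF c(1)] by blast
  then have Id: "Id \<subseteq> map_prod \<rho> \<sigma> ` Id" by (rule alcove_type_cell(2)[OF k(2)])
  show "\<rho> = \<sigma>"
  proof
    fix i
    have "(\<rho> i, \<rho> i) \<in> map_prod \<rho> \<sigma> ` Id" using Id by blast
    then obtain m where "\<rho> m = \<rho> i" "\<sigma> m = \<rho> i" by auto
    then show "\<rho> i = \<sigma> i" using bij(1) by (metis bij_is_inj injD)
  qed
  with eq' show "alcove_types c' = image (map_prod \<sigma> \<sigma>) ` alcove_types c" by simp
qed

lemma config_equiv_imp_same_type:
  assumes V: "trop_config V" "generated_by V c \<pi>" and W: "trop_config W" "generated_by W c' \<pi>'"
    and c: "strict_star c" "strict_star c'" and equiv: "config_equiv V W"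
  shows "same_type c c'"
proof -
  note k = c[THEN strict_star_kleene]
  define N where "N = {..<length V}"
  obtain \<tau> \<sigma> where \<tau>: "\<tau> permutes N" and \<sigma>: "\<sigma> permutes UNIV"
    and "bij_betw (image (map_prod \<tau> \<sigma>)) (TC V) (TC W)" and len: "length V = length W"
    using equiv unfolding config_equiv_def N_def by blast
  then have TC: "TC W = image (map_prod \<tau> \<sigma>) ` TC V" by (simp add: bij_betw_def)
  have \<pi>: "bij_betw \<pi> N UNIV" and \<pi>': "bij_betw \<pi>' N UNIV"
    using V(2) W(2) by (simp_all add: generated_by_def N_def len)
  \<comment> \<open>The permutation \<open>\<tau>\<close> of positions, read as a permutation of
    column names.\<close>
  define \<rho> where "\<rho> = \<pi>' \<circ> \<tau> \<circ> inv_into N \<pi>"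
  have "bij \<rho>"
    unfolding \<rho>_def comp_assoc
    by (intro bij_betw_trans[OF bij_betw_inv_into[OF \<pi>]] bij_betw_trans[OF _ \<pi>'] permutes_imp_bij[OF \<tau>])
  have "\<rho> (\<pi> n) = \<pi>' (\<tau> n)" if "n \<in> N" for n
    using that \<pi> by (simp add: \<rho>_def bij_betw_def)
  then have map_eq: "map_prod \<rho> \<sigma> ` map_prod \<pi> id ` F = map_prod \<pi>' id ` map_prod \<tau> \<sigma> ` F" if "F \<in> TC V" for F
    using TC_subset[OF that] unfolding image_image N_def by (intro image_cong) auto
  have "image (map_prod \<rho> \<sigma>) ` image (map_prod \<pi> id) ` TC V =
      image (map_prod \<pi>' id) ` image (map_prod \<tau> \<sigma>) ` TC V"
    unfolding image_image[of "image _" "image _"] by (rule image_cong[OF refl map_eq])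
  then have eq: "cov_types c' = image (map_prod \<rho> \<sigma>) ` cov_types c"
    using TC TC_generated[OF V(1) k(1) V(2)] TC_generated[OF W(1) k(2) W(2)] by metis
  have "bij \<sigma>" using \<sigma> by (rule permutes_bij)
  then show ?thesis
    unfolding same_type_def using same_labelling(2)[OF c \<open>bij \<rho>\<close> _ eq] by (intro exI[of _ \<sigma>] conjI)
qed

lemma same_type_imp_config_equiv:
  assumes V: "trop_config V" "generated_by V c \<pi>" and W: "trop_config W" "generated_by W c' \<pi>'"
    and c: "strict_star c" "strict_star c'" and same: "same_type c c'"
  shows "config_equiv V W"
proof -
  note k = c[THEN strict_star_kleene]
  define N where "N = {..<length V}"
  have "bij_betw \<pi> N UNIV" "bij_betw \<pi>' {..<length W} UNIV"
    using V(2) W(2) by (auto simp: generated_by_def N_def)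
  then have len: "length W = length V" by (metis N_def bij_betw_same_card card_lessThan)
  have \<pi>: "bij_betw \<pi> N UNIV" and \<pi>': "bij_betw \<pi>' N UNIV"
    using V(2) W(2) len by (auto simp: generated_by_def N_def)
  obtain \<sigma> where \<sigma>: "bij \<sigma>" "alcove_types c' = image (map_prod \<sigma> \<sigma>) ` alcove_types c"
    using same by (auto simp: same_type_def)
  \<comment> \<open>Forced by \<open>\<pi>' (\<tau> n) = \<sigma> (\<pi> n)\<close> on the
    positions; the identity elsewhere, as \<open>permutes\<close> demands.\<close>
  define \<tau> where "\<tau> n = (if n \<in> N then inv_into N \<pi>' (\<sigma> (\<pi> n)) else n)" for n
  have "bij_betw (inv_into N \<pi>' \<circ> (\<sigma> \<circ> \<pi>)) N N"
    by (intro bij_betw_trans[OF _ bij_betw_inv_into[OF \<pi>']] bij_betw_trans[OF \<pi> \<sigma>(1)])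
  then have "bij_betw \<tau> N N" by (rule bij_betw_cong[THEN iffD1, rotated]) (simp add: \<tau>_def)
  then have \<tau>: "\<tau> permutes N" by (rule bij_imp_permutes) (simp add: \<tau>_def)
  have \<sigma>': "\<sigma> permutes UNIV" using \<sigma>(1) by (simp add: permutes_UNIV_iff_bij)
  have \<pi>'\<tau>: "\<pi>' (\<tau> n) = \<sigma> (\<pi> n)" if "n \<in> N" for n
    using that \<pi>' by (simp add: \<tau>_def bij_betw_def f_inv_into_f)
  have map_eq: "map_prod \<pi>' id ` map_prod \<tau> \<sigma> ` F = map_prod \<sigma> \<sigma> ` map_prod \<pi> id ` F" if "F \<in> TC V" for F
    using TC_subset[OF that] \<pi>'\<tau> unfolding image_image N_def by (intro image_cong) auto
  have "image (map_prod \<pi>' id) ` image (map_prod \<tau> \<sigma>) ` TC V =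
      image (map_prod \<sigma> \<sigma>) ` image (map_prod \<pi> id) ` TC V"
    unfolding image_image[of "image _" "image _"] by (rule image_cong[OF refl map_eq])
  also have "\<dots> = image (map_prod \<pi>' id) ` TC W"
    unfolding TC_generated[OF V(1) k(1) V(2)] TC_generated[OF W(1) k(2) W(2)]
    by (rule cov_types_relabel[OF k \<sigma>, symmetric])
  finally have eq: "image (map_prod \<pi>' id) ` image (map_prod \<tau> \<sigma>) ` TC V = image (map_prod \<pi>' id) ` TC W" .
  \<comment> \<open>Injectivity of \<open>\<pi>'\<close> is known on the positions only, so it is
    cancelled between families of graphs confined to \<open>N\<close>.\<close>
  have "inj_on (map_prod \<pi>' id) (N \<times> UNIV)"
    using \<pi>' by (auto simp: inj_on_def bij_betw_def)
  then have inj_on: "inj_on (image (map_prod \<pi>' id)) (Pow (N \<times> UNIV))" by (rule inj_on_image_Pow)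
  have V_sub: "image (map_prod \<tau> \<sigma>) ` TC V \<subseteq> Pow (N \<times> UNIV)"
    using TC_subset permutes_in_image[OF \<tau>] by (fastforce simp: N_def)
  have W_sub: "TC W \<subseteq> Pow (N \<times> UNIV)"
    using TC_subset[of _ W] unfolding N_def len[symmetric] by blast
  have TC: "image (map_prod \<tau> \<sigma>) ` TC V = TC W"
    using eq unfolding inj_on_image_eq_iff[OF inj_on V_sub W_sub] .
  have inj: "inj (map_prod \<tau> \<sigma>)"
    using permutes_inj[OF \<tau>] permutes_inj[OF \<sigma>'] by (rule prod.inj_map)
  have "bij_betw (image (map_prod \<tau> \<sigma>)) (TC V) (TC W)"
    using TC by (simp add: bij_betw_def inj_on_def inj_image_eq_iff[OF inj])
  moreover have "\<forall>E\<in>TC V. \<forall>F\<in>TC V. E \<subseteq> F \<longleftrightarrow> map_prod \<tau> \<sigma> ` E \<subseteq> map_prod \<tau> \<sigma> ` F"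
    unfolding inj_image_subset_iff[OF inj] by (intro ballI refl)
  ultimately show ?thesis
    using \<tau> \<sigma>' len[symmetric] unfolding config_equiv_def N_def
    by (intro conjI exI[of _ \<tau>] exI[of _ \<sigma>])
qed

lemma polytrope_equiv_iff:
  fixes c c' :: "'n::finite \<Rightarrow> 'n \<Rightarrow> ereal"
  assumes c: "strict_star c" "strict_star c'"
  shows "(alcove c, alcove c') \<in> polytrope_equiv \<longleftrightarrow> same_type c c'"
proof
  assume "(alcove c, alcove c') \<in> polytrope_equiv"
  then obtain V W where V: "trop_config V" "irredundant V" "tconv V = alcove c"
    and W: "trop_config W" "irredundant W" "tconv W = alcove c'" and equiv: "config_equiv V W"
    unfolding polytrope_equiv_def by auto
  obtain \<pi> \<pi>' where "generated_by V c \<pi>" "generated_by W c' \<pi>'"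
    using irredundant_generators[OF V(1,2) c(1) V(3)] irredundant_generators[OF W(1,2) c(2) W(3)] by metis
  then show "same_type c c'" using config_equiv_imp_same_type V(1) W(1) c equiv by blast
next
  assume same: "same_type c c'"
  obtain V W where V: "trop_config V" "irredundant V" "tconv V = alcove c"
    and W: "trop_config W" "irredundant W" "tconv W = alcove c'"
    using obtain_irredundant_generators[OF c(1)] obtain_irredundant_generators[OF c(2)] by metis
  obtain \<pi> \<pi>' where "generated_by V c \<pi>" "generated_by W c' \<pi>'"
    using irredundant_generators[OF V(1,2) c(1) V(3)] irredundant_generators[OF W(1,2) c(2) W(3)] by metis
  then have "config_equiv V W" using same_type_imp_config_equiv V(1) W(1) c same by blast
  moreover have "alcove c \<in> full_dim_polytropes" "alcove c' \<in> full_dim_polytropes"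
    unfolding full_dim_polytropes_eq using c by blast+
  ultimately show "(alcove c, alcove c') \<in> polytrope_equiv"
    unfolding polytrope_equiv_def using V W by blast
qed

section \<open>Passage to the quotients\<close>

lemma same_type_refl: "same_type c c"
  unfolding same_type_def by (intro exI[of _ id]) (simp add: map_prod.id)

lemma same_type_sym: "same_type c c' \<Longrightarrow> same_type c' c"
  unfolding same_type_def using alcove_types_inv bij_imp_bij_inv by metis

lemma same_type_trans:
  assumes "same_type c1 c2" "same_type c2 c3"
  shows "same_type c1 c3"
proof -
  obtain \<sigma> \<tau> where "bij \<sigma>" "alcove_types c2 = image (map_prod \<sigma> \<sigma>) ` alcove_types c1"
    "bij \<tau>" "alcove_types c3 = image (map_prod \<tau> \<tau>) ` alcove_types c2"
    using assms by (auto simp: same_type_def)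
  then have "bij (\<tau> \<circ> \<sigma>)" "alcove_types c3 = image (map_prod (\<tau> \<circ> \<sigma>) (\<tau> \<circ> \<sigma>)) ` alcove_types c1"
    by (auto intro: bij_comp simp: image_image map_prod.comp[symmetric])
  then show ?thesis unfolding same_type_def by blast
qed

text \<open>Both quotients are copies of \<open>X\<close> modulo \<open>E\<close>. As
  \<open>f\<close> and \<open>g\<close> may identify indices, \<open>\<phi>\<close> pulls a class
  back to all of its indices before applying \<open>g\<close>.\<close>

lemma quotients_bij:
  assumes R: "R \<subseteq> f ` X \<times> f ` X" "\<And>x y. x \<in> X \<Longrightarrow> y \<in> X \<Longrightarrow> (f x, f y) \<in> R \<longleftrightarrow> E x y"
    and S: "S \<subseteq> g ` X \<times> g ` X" "\<And>x y. x \<in> X \<Longrightarrow> y \<in> X \<Longrightarrow> (g x, g y) \<in> S \<longleftrightarrow> E x y"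
    and refl: "\<And>x. x \<in> X \<Longrightarrow> E x x"
    and sym: "\<And>x y. x \<in> X \<Longrightarrow> y \<in> X \<Longrightarrow> E x y \<Longrightarrow> E y x"
    and trans: "\<And>x y z. x \<in> X \<Longrightarrow> y \<in> X \<Longrightarrow> z \<in> X \<Longrightarrow> E x y \<Longrightarrow> E y z \<Longrightarrow> E x z"
  shows "\<exists>\<phi>. bij_betw \<phi> ((f ` X) // R) ((g ` X) // S)"
proof -
  define \<phi> where "\<phi> Q = g ` {y \<in> X. f y \<in> Q}" for Q
  have \<phi>: "\<phi> (R `` {f x}) = S `` {g x}" if x: "x \<in> X" for x
  proof -
    have "{y \<in> X. f y \<in> R `` {f x}} = {y \<in> X. E x y}" using R(2) x by auto
    then have "\<phi> (R `` {f x}) = g ` {y \<in> X. E x y}" by (simp add: \<phi>_def)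
    also have "\<dots> = S `` {g x}" using S x by fastforce
    finally show ?thesis .
  qed
  have inj: "R `` {f x} = R `` {f x'}" if x: "x \<in> X" "x' \<in> X" and eq: "S `` {g x} = S `` {g x'}" for x x'
  proof -
    have "(g x', g x') \<in> S" using S(2) x refl by blast
    then have "(g x, g x') \<in> S" using eq by blast
    then have "E x x'" using S(2) x by blast
    then have "{y \<in> X. E x y} = {y \<in> X. E x' y}" using x sym trans by blast
    moreover have "R `` {f z} = f ` {y \<in> X. E z y}" if "z \<in> X" for z
      using R that by fastforce
    ultimately show ?thesis using x by simp
  qed
  have "bij_betw \<phi> ((f ` X) // R) ((g ` X) // S)"
  proof (rule bij_betw_imageI)
    show "inj_on \<phi> ((f ` X) // R)"
    proof (rule inj_onI)
      fix Q Q' assume "Q \<in> (f ` X) // R" "Q' \<in> (f ` X) // R" and eq: "\<phi> Q = \<phi> Q'"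
      then obtain x x' where x: "x \<in> X" "x' \<in> X" "Q = R `` {f x}" "Q' = R `` {f x'}"
        unfolding quotient_def by blast
      then show "Q = Q'" using inj[OF x(1,2)] eq \<phi> by simp
    qed
    have "\<phi> ` ((f ` X) // R) = (\<lambda>x. \<phi> (R `` {f x})) ` X" unfolding quotient_def by blast
    also have "\<dots> = (\<lambda>x. S `` {g x}) ` X" using \<phi> by (intro image_cong) auto
    also have "\<dots> = (g ` X) // S" unfolding quotient_def by blast
    finally show "\<phi> ` ((f ` X) // R) = (g ` X) // S" .
  qed
  then show ?thesis by blast
qed

theorem theorem3p9:
  "\<exists>f. bij_betw f (polytrope_types :: (real^'n) set set set)
                 (subdivision_types :: (real^'n) set set set set)"
proof -
  let ?X = "{c :: 'n \<Rightarrow> 'n \<Rightarrow> ereal. strict_star c}"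
  have "\<exists>f. bij_betw f ((alcove ` ?X) // polytrope_equiv) ((star_subdivision ` ?X) // subdivision_equiv)"
  proof (rule quotients_bij[where E = same_type])
    show "polytrope_equiv \<subseteq> alcove ` ?X \<times> alcove ` ?X"
      unfolding full_dim_polytropes_eq[symmetric] by (auto simp: polytrope_equiv_def)
    show "subdivision_equiv \<subseteq> star_subdivision ` ?X \<times> star_subdivision ` ?X"
      unfolding regular_central_subdivisions_eq[symmetric] by (auto simp: subdivision_equiv_def)
  qed (auto simp: polytrope_equiv_iff subdivision_equiv_iff
      intro: same_type_refl same_type_sym same_type_trans)
  then show ?thesis
    unfolding polytrope_types_def subdivision_types_def full_dim_polytropes_eq regular_central_subdivisions_eq .
qed

end
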